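(* Let $H$ be a graph with $\chi(H)=3$ that contains a critical edge and has odd girth at least $5$. Then ${\delta_{\text{lin-rem}}}(H)\leq\frac14$.
   Context: Copies of $H$ are labeled copies. For $\varepsilon>0$ and $\gamma\in[0,1]$, $\delta(\varepsilon,H;\gamma)$ is the maximum $\delta\in[0,1]$ such that every $n$-vertex graph with minimum degree at least $\gamma n$ containing $\varepsilon n^2$ edge-disjoint copies of $H$ contains at least $\delta n^{v(H)}$ copies of $H$. ${\delta_{\text{lin-rem}}}(H)$ is the infimum of those $\gamma$ for which there is $\mu=\mu(\gamma)>0$ with $\delta(\varepsilon,H;\gamma)\geq\mu\varepsilon$ for all $\varepsilon>0$. An edge $xy$ of $H$ is critical if $\chi(H-xy)<\chi(H)$. The odd girth is the length of a shortest odd cycle.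
   Formalization: In the definition of δ_lin-rem, ε ranges over (0,1] instead of all ε>0: since δ(ε,H;γ)≤1, the bound δ≥με fails for every μ>0 once ε>1/μ, and for ε>1 the condition is vacuous. Host graphs have natural numbers as vertices. *)

theory Defs
  imports
    Complex_Main
    "HOL-Library.Disjoint_Sets"
    "HOL-Library.Extended_Nat"
    "HOL-Library.FuncSet"
    "Graph_Theory.Graph_Theory"
begin

text \<open>
  Finite simple graphs are the symmetric, loop-free digraphs of the locale \<^locale>\<open>pair_graph\<close>:
  an edge \<open>xy\<close> is the pair of arcs \<open>(x, y)\<close>, \<open>(y, x)\<close>, and the degree of a vertex is its
  out-degree.
\<close>

definition proper_colouring :: "'a pair_pre_digraph \<Rightarrow> nat \<Rightarrow> ('a \<Rightarrow> nat) \<Rightarrow> bool" where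
  "proper_colouring G k c \<longleftrightarrow>
     c ` pverts G \<subseteq> {..<k} \<and> (\<forall>(x, y) \<in> parcs G. c x \<noteq> c y)"

definition chromatic_number :: "'a pair_pre_digraph \<Rightarrow> nat" where
  "chromatic_number G = (LEAST k. \<exists>c. proper_colouring G k c)"

definition del_edge :: "'a pair_pre_digraph \<Rightarrow> 'a \<Rightarrow> 'a \<Rightarrow> 'a pair_pre_digraph" where
  "del_edge G x y = G\<lparr>parcs := parcs G - {(x, y), (y, x)}\<rparr>"

definition critical_edge :: "'a pair_pre_digraph \<Rightarrow> 'a \<Rightarrow> 'a \<Rightarrow> bool" where
  "critical_edge G x y \<longleftrightarrow>
     (x, y) \<in> parcs G \<and> chromatic_number (del_edge G x y) < chromatic_number G"

text \<open>
  The library's cycles include the closed walks \<open>x \<rightarrow> y \<rightarrow> x\<close> along a single edge; these have even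
  length, so in a loop-free graph every odd cycle is a genuine one, of length at least 3.
  The odd girth of a graph without odd cycles is \<open>\<infinity>\<close>.
\<close>

definition odd_girth :: "'a pair_pre_digraph \<Rightarrow> enat" where
  "odd_girth G = (INF p \<in> {p. pre_digraph.cycle G p \<and> odd (length p)}. enat (length p))"

definition labelled_copies ::
    "'a pair_pre_digraph \<Rightarrow> 'b pair_pre_digraph \<Rightarrow> ('a \<Rightarrow> 'b) set" where
  "labelled_copies H G =
     {f \<in> pverts H \<rightarrow>\<^sub>E pverts G. inj_on f (pverts H) \<and>
        (\<forall>(x, y) \<in> parcs H. (f x, f y) \<in> parcs G)}"

definition edge_disjoint_copies ::
    "'a pair_pre_digraph \<Rightarrow> 'b pair_pre_digraph \<Rightarrow> ('a \<Rightarrow> 'b) set \<Rightarrow> bool" where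
  "edge_disjoint_copies H G F \<longleftrightarrow>
     F \<subseteq> labelled_copies H G \<and> disjoint_family_on (\<lambda>f. map_prod f f ` parcs H) F"

text \<open>
  Every finite graph is isomorphic to one with vertices in \<^typ>\<open>nat\<close>, so quantifying over graphs
  on \<^typ>\<open>nat\<close> is quantifying over all finite graphs.
\<close>

definition removal_bound ::
    "real \<Rightarrow> 'a pair_pre_digraph \<Rightarrow> real \<Rightarrow> real \<Rightarrow> bool" where
  "removal_bound \<epsilon> H \<gamma> d \<longleftrightarrow>
     (\<forall>(G :: nat pair_pre_digraph) n.
        pair_graph G \<and> card (pverts G) = n \<and>
        (\<forall>v \<in> pverts G. real (out_degree G v) \<ge> \<gamma> * real n) \<and>
        (\<exists>F. edge_disjoint_copies H G F \<and> real (card F) \<ge> \<epsilon> * real n ^ 2)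
        \<longrightarrow> real (card (labelled_copies H G)) \<ge> d * real n ^ card (pverts H))"

definition removal_delta :: "real \<Rightarrow> 'a pair_pre_digraph \<Rightarrow> real \<Rightarrow> real" where
  "removal_delta \<epsilon> H \<gamma> = (GREATEST d. d \<in> {0..1} \<and> removal_bound \<epsilon> H \<gamma> d)"

lemma removal_delta_is_maximum:
  "removal_delta \<epsilon> H \<gamma> \<in> {0..1} \<and> removal_bound \<epsilon> H \<gamma> (removal_delta \<epsilon> H \<gamma>)"
  "d \<in> {0..1} \<Longrightarrow> removal_bound \<epsilon> H \<gamma> d \<Longrightarrow> d \<le> removal_delta \<epsilon> H \<gamma>"
proof -
  let ?P = "\<lambda>d. d \<in> {0..1} \<and> removal_bound \<epsilon> H \<gamma> d"
  let ?S = "Collect ?P"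
  have zero: "0 \<in> ?S" by (auto simp: removal_bound_def)
  have bdd: "bdd_above ?S" by (rule bdd_aboveI[of _ 1]) auto
  have le: "d \<le> Sup ?S" if "?P d" for d using cSup_upper[OF _ bdd, of d] that by simp
  have "removal_bound \<epsilon> H \<gamma> (Sup ?S)"
  proof (rule removal_bound_def[THEN iffD2], intro allI impI)
    fix G :: "nat pair_pre_digraph" and n
    assume G: "pair_graph G \<and> card (pverts G) = n \<and>
      (\<forall>v \<in> pverts G. real (out_degree G v) \<ge> \<gamma> * real n) \<and>
      (\<exists>F. edge_disjoint_copies H G F \<and> real (card F) \<ge> \<epsilon> * real n ^ 2)"
    let ?c = "real (card (labelled_copies H G))" and ?m = "real n ^ card (pverts H)"
    have b: "d * ?m \<le> ?c" if "?P d" for d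
      using that G unfolding removal_bound_def by blast
    show "Sup ?S * ?m \<le> ?c"
    proof (cases "?m = 0")
      case False
      then have m: "?m > 0" by (simp add: zero_less_power)
      have "Sup ?S \<le> ?c / ?m"
      proof (rule cSup_least)
        show "?S \<noteq> {}" using zero by blast
        show "d \<le> ?c / ?m" if "d \<in> ?S" for d
          using b[of d] that m by (simp only: mem_Collect_eq pos_le_divide_eq)
      qed
      then show ?thesis using m by (simp add: pos_le_divide_eq)
    next
      case True
      then show ?thesis by (simp only: mult_zero_right of_nat_0_le_iff)
    qed
  qed
  moreover have "Sup ?S \<in> {0..1}"
    using le[of 0] zero by (auto intro!: cSup_least)
  ultimately have max: "?P (Sup ?S)" by simp
  then have eq: "removal_delta \<epsilon> H \<gamma> = Sup ?S"
    unfolding removal_delta_def by (intro Greatest_equality) (use le in auto)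
  show "removal_delta \<epsilon> H \<gamma> \<in> {0..1} \<and> removal_bound \<epsilon> H \<gamma> (removal_delta \<epsilon> H \<gamma>)"
    "d \<in> {0..1} \<Longrightarrow> removal_bound \<epsilon> H \<gamma> d \<Longrightarrow> d \<le> removal_delta \<epsilon> H \<gamma>"
    using max le unfolding eq by auto
qed

lemma card_edge_disjoint_copies_le:
  assumes "pair_graph G" "parcs H \<noteq> {}" "edge_disjoint_copies H G F"
  shows "card F \<le> card (pverts G) ^ 2"
proof -
  interpret pair_graph G by fact
  from assms(2) obtain x y where xy: "(x, y) \<in> parcs H" by auto
  let ?h = "\<lambda>f. (f x, f y)"
  have "inj_on ?h F"
  proof (rule inj_onI, rule ccontr)
    fix f g assume fg: "f \<in> F" "g \<in> F" "?h f = ?h g" "f \<noteq> g"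
    then have "map_prod f f ` parcs H \<inter> map_prod g g ` parcs H = {}"
      using assms(3) by (auto simp: edge_disjoint_copies_def disjoint_family_on_def)
    moreover have "?h f \<in> map_prod f f ` parcs H" "?h g \<in> map_prod g g ` parcs H"
      using xy by force+
    ultimately show False using fg(3) by (metis IntI empty_iff)
  qed
  moreover have "?h ` F \<subseteq> pverts G \<times> pverts G"
    using assms(3) xy in_arcsD1 in_arcsD2
    by (force simp: edge_disjoint_copies_def labelled_copies_def)
  ultimately have "card F \<le> card (pverts G \<times> pverts G)"
    using pair_finite_verts by (intro card_inj_on_le[of ?h]) auto
  then show ?thesis by (simp add: card_cartesian_product power2_eq_square)
qed

text \<open>
  Only \<open>\<epsilon> \<le> 1\<close> is meaningful. If \<open>H\<close> has an edge then for \<open>\<epsilon> > 1\<close> no nonempty graph contains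
  \<open>\<epsilon> n\<^sup>2\<close> edge-disjoint copies of \<open>H\<close>, so the maximum over \<open>[0,1]\<close> is \<open>1\<close> by default; a bound
  \<open>\<mu> \<epsilon> \<le> 1\<close> for arbitrarily large \<open>\<epsilon>\<close> would then fail for every \<open>\<mu> > 0\<close>. Hence \<open>\<epsilon>\<close> ranges
  over \<open>(0,1]\<close> in the definition of the linear removal threshold.
\<close>

lemma removal_delta_vacuous:
  assumes "pair_graph H" "parcs H \<noteq> {}" "\<epsilon> > 1"
  shows "removal_delta \<epsilon> H \<gamma> = 1"
proof -
  interpret H: pair_graph H by fact
  have H: "card (pverts H) > 0"
    using assms(2) H.pair_finite_verts H.in_arcsD1 by (auto simp: card_gt_0_iff)
  have "removal_bound \<epsilon> H \<gamma> 1"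
    unfolding removal_bound_def
  proof (intro allI impI, elim conjE exE)
    fix G :: "nat pair_pre_digraph" and n F
    assume G: "pair_graph G" "card (pverts G) = n" "edge_disjoint_copies H G F"
      "real (card F) \<ge> \<epsilon> * real n ^ 2"
    have "real (card F) \<le> real n ^ 2"
      using card_edge_disjoint_copies_le[OF G(1) assms(2) G(3)] G(2)
      by (metis of_nat_le_iff of_nat_power)
    then have "\<epsilon> * real n ^ 2 \<le> 1 * real n ^ 2" using G(4) by linarith
    then have "n = 0" using assms(3) by (metis mult_le_cancel_right_pos not_less of_nat_0_less_iff zero_less_power neq0_conv)
    then show "real (card (labelled_copies H G)) \<ge> 1 * real n ^ card (pverts H)"
      using H by (simp add: zero_power)
  qed
  then show ?thesis using removal_delta_is_maximum(1)[of \<epsilon> H \<gamma>] removal_delta_is_maximum(2)[of 1 \<epsilon> H \<gamma>] by force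
qed

definition delta_lin_rem :: "'a pair_pre_digraph \<Rightarrow> real" where
  "delta_lin_rem H =
     Inf {\<gamma> \<in> {0..1}. \<exists>\<mu>>0. \<forall>\<epsilon>. 0 < \<epsilon> \<and> \<epsilon> \<le> 1 \<longrightarrow> removal_delta \<epsilon> H \<gamma> \<ge> \<mu> * \<epsilon>}"

end

theory Submission
  imports Defs "HOL-Analysis.Convex"
begin

text \<open>
  Let \<open>xy\<close> be a critical edge of \<open>H\<close>. Since \<open>H - xy\<close> is bipartite and \<open>H\<close> is triangle-free, \<open>H\<close>
  lies in the blow-up of a 5-cycle in which \<open>x\<close> and \<open>y\<close> are not blown up; if \<open>xy\<close> lies in no
  5-cycle of \<open>H\<close>, then the same is true for a 7-cycle. Hence an edge \<open>ab\<close> of the host graph that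
  lies in a positive proportion of all possible 5-cycles (or 7-cycles, if \<open>xy\<close> lies in no 5-cycle)
  plays the role of \<open>xy\<close> in order \<open>n ^ (v(H) - 2)\<close> copies of \<open>H\<close>; call edges with so many copies
  rich. It is enough to show that either a positive proportion of all pairs are rich edges, or every
  copy of \<open>H\<close> contains a rich edge, since edge-disjoint copies then yield different rich edges.

  Minimum degree above \<open>n/4\<close> means that among any four vertices two have linearly many common
  neighbours. If rich edges are rare and a copy of \<open>H\<close> contains none, averaging this over
  suitable quadruples contradicts the existence of a 5-cycle in the copy, or, in the 7-cycle case,
  of any odd closed walk in the copy.
\<close>

section \<open>Averages over finite sets\<close>

definition avg :: "'b set \<Rightarrow> ('b \<Rightarrow> real) \<Rightarrow> real" where
  "avg S f = (\<Sum>x\<in>S. f x) / real (card S)"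

lemma avg_const: "finite S \<Longrightarrow> S \<noteq> {} \<Longrightarrow> avg S (\<lambda>_. c) = c"
  by (simp add: avg_def)

lemma avg_add: "avg S (\<lambda>x. f x + g x) = avg S f + avg S g"
  by (simp add: avg_def sum.distrib add_divide_distrib)

lemma avg_sum: "avg S (\<lambda>x. \<Sum>i\<in>I. f i x) = (\<Sum>i\<in>I. avg S (f i))"
  unfolding avg_def by (subst sum.swap) (simp add: sum_divide_distrib)

lemma avg_mult_left: "avg S (\<lambda>x. c * f x) = c * avg S f"
  by (simp add: avg_def sum_distrib_left)

lemma avg_mult_right: "avg S (\<lambda>x. f x * c) = avg S f * c"
  by (simp add: avg_def sum_distrib_right)

lemma avg_mono: "(\<And>x. x \<in> S \<Longrightarrow> f x \<le> g x) \<Longrightarrow> avg S f \<le> avg S g"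
  by (simp add: avg_def divide_right_mono sum_mono)

lemma avg_cong: "(\<And>x. x \<in> S \<Longrightarrow> f x = g x) \<Longrightarrow> avg S f = avg S g"
  by (simp add: avg_def)

lemma avg_nonneg: "(\<And>x. x \<in> S \<Longrightarrow> 0 \<le> f x) \<Longrightarrow> 0 \<le> avg S f"
  by (simp add: avg_def sum_nonneg)

lemma avg_le:
  assumes "finite S" "S \<noteq> {}" "\<And>x. x \<in> S \<Longrightarrow> f x \<le> c"
  shows "avg S f \<le> c"
  using avg_mono[of S f "\<lambda>_. c"] assms by (simp add: avg_const)

lemma avg_swap: "avg S (\<lambda>x. avg T (f x)) = avg T (\<lambda>y. avg S (\<lambda>x. f x y))"
  unfolding avg_def sum_divide_distrib[symmetric] by (subst sum.swap) simp

lemma avg_square: "(avg S f)\<^sup>2 \<le> avg S (\<lambda>x. (f x)\<^sup>2)"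
proof (cases "card S = 0")
  case False
  then show ?thesis
    using sum_squared_le_sum_of_squares[of f S]
    by (simp add: avg_def power_divide power2_eq_square divide_simps)
qed (simp add: avg_def)

lemma avg_of_bool:
  "finite S \<Longrightarrow> avg S (\<lambda>x. of_bool (P x)) = real (card {x \<in> S. P x}) / real (card S)"
  by (simp add: avg_def Int_def)

lemma avg_singleton: "avg {x} f = f x"
  by (simp add: avg_def)

lemma avg_PiE_insert:
  assumes "i \<notin> I"
  shows "avg (insert i I \<rightarrow>\<^sub>E V) f = avg V (\<lambda>v. avg (I \<rightarrow>\<^sub>E V) (\<lambda>p. f (p(i := v))))"
proof -
  have inj: "inj_on (\<lambda>(v, p). p(i := v)) (V \<times> (I \<rightarrow>\<^sub>E V))"
    using inj_combinator[OF assms, of "\<lambda>_. V"] by simp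
  then show ?thesis
    by (simp add: avg_def PiE_insert_eq sum.reindex card_image card_cartesian_product
        sum.cartesian_product' split_def flip: sum_divide_distrib)
qed

section \<open>Blow-ups\<close>

definition transversals ::
    "'i set \<Rightarrow> ('i \<Rightarrow> 'v) \<Rightarrow> ('u \<Rightarrow> 'i) \<Rightarrow> 'u set \<Rightarrow> ('u \<Rightarrow> 'v) \<Rightarrow> ('i \<Rightarrow> 'v) set" where
  "transversals I p \<psi> U f = (\<Pi>\<^sub>E i\<in>I. insert (p i) (f ` {u \<in> U. \<psi> u = i}))"

lemma transversals_empty:
  assumes "p \<in> I \<rightarrow>\<^sub>E V"
  shows "transversals I p \<psi> {} f = {p}"
  using assms by (simp add: transversals_def PiE_singleton PiE_iff)

lemma transversals_insert:
  assumes "u \<notin> U" and s: "s \<in> transversals I p \<psi> (insert u U) (f(u := v))"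
  shows "s \<in> transversals I p \<psi> U f \<or> s \<in> transversals I (p(\<psi> u := v)) \<psi> U f"
proof -
  have image: "(f(u := v)) ` {w \<in> insert u U. \<psi> w = i}
      = (if i = \<psi> u then insert v (f ` {w \<in> U. \<psi> w = i}) else f ` {w \<in> U. \<psi> w = i})" for i
    using assms(1) by (auto simp: image_iff)
  show ?thesis
    using s unfolding transversals_def image
    by (cases "s (\<psi> u) = v") (auto simp: PiE_iff split: if_splits)
qed

text \<open>
  Sampling \<open>v\<close> and \<open>v'\<close> independently for one coordinate \<open>i\<close> of \<open>p\<close>, by Cauchy--Schwarz both choices
  work with probability at least the square of the former one; \<open>v\<close> serves as the image of a new
  vertex of class \<open>i\<close>. The coordinate \<open>p i\<close> stays available, so that empty classes do no harm.
\<close>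

lemma transversals_density_square_le:
  fixes W :: "('i \<Rightarrow> 'v) \<Rightarrow> bool" and \<psi> :: "'u \<Rightarrow> 'i"
  assumes "u \<notin> U" "\<psi> u \<in> I"
  defines "good \<equiv> \<lambda>U p f. \<forall>s \<in> transversals I p \<psi> U f. W s"
  shows "(avg (U \<rightarrow>\<^sub>E V) (\<lambda>f. avg (I \<rightarrow>\<^sub>E V) (\<lambda>p. of_bool (good U p f))))\<^sup>2
    \<le> avg (insert u U \<rightarrow>\<^sub>E V) (\<lambda>f. avg (I \<rightarrow>\<^sub>E V) (\<lambda>p. of_bool (good (insert u U) p f)))"
proof -
  define i J where "i = \<psi> u" and "J = I - {i}"
  have I: "I = insert i J" "i \<notin> J" using assms(2) by (auto simp: i_def J_def)
  define h where "h f q v = (of_bool (good U (q(i := v)) f) :: real)" for f q v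
  have duplicate: "h f q v * h f q v' \<le> of_bool (good (insert u U) (q(i := v')) (f(u := v)))"
    for f q v v'
    using transversals_insert[OF assms(1), of _ I "q(i := v')" \<psi> f v]
    unfolding h_def good_def i_def[symmetric] by (auto simp flip: of_bool_conj)
  have "avg (I \<rightarrow>\<^sub>E V) (\<lambda>p. of_bool (good U p f)) = avg (J \<rightarrow>\<^sub>E V) (\<lambda>q. avg V (h f q))" for f
    unfolding I(1) avg_PiE_insert[OF I(2)] h_def by (rule avg_swap)
  then have "(avg (U \<rightarrow>\<^sub>E V) (\<lambda>f. avg (I \<rightarrow>\<^sub>E V) (\<lambda>p. of_bool (good U p f))))\<^sup>2
      = (avg (U \<rightarrow>\<^sub>E V) (\<lambda>f. avg (J \<rightarrow>\<^sub>E V) (\<lambda>q. avg V (h f q))))\<^sup>2" by simp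
  also have "\<dots> \<le> avg (U \<rightarrow>\<^sub>E V) (\<lambda>f. avg (J \<rightarrow>\<^sub>E V) (\<lambda>q. (avg V (h f q))\<^sup>2))"
    by (rule order.trans[OF avg_square avg_mono]) (rule avg_square)
  also have "\<dots> = avg (U \<rightarrow>\<^sub>E V) (\<lambda>f. avg (J \<rightarrow>\<^sub>E V) (\<lambda>q. avg V (\<lambda>v. avg V (\<lambda>v'. h f q v * h f q v'))))"
    by (simp add: power2_eq_square avg_mult_left avg_mult_right)
  also have "\<dots> \<le> avg (U \<rightarrow>\<^sub>E V) (\<lambda>f. avg (J \<rightarrow>\<^sub>E V) (\<lambda>q. avg V (\<lambda>v. avg V (\<lambda>v'.
      of_bool (good (insert u U) (q(i := v')) (f(u := v)))))))"
    by (intro avg_mono duplicate)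
  also have "\<dots> = avg (insert u U \<rightarrow>\<^sub>E V) (\<lambda>f. avg (I \<rightarrow>\<^sub>E V) (\<lambda>p. of_bool (good (insert u U) p f)))"
    by (simp only: I(1) avg_PiE_insert[OF I(2)] avg_PiE_insert[OF assms(1)]
        avg_swap[of V "J \<rightarrow>\<^sub>E V"] avg_swap[of V "U \<rightarrow>\<^sub>E V"])
  finally show ?thesis .
qed

lemma blowup_density:
  assumes "finite U" "\<psi> ` U \<subseteq> I"
  shows "avg (I \<rightarrow>\<^sub>E V) (\<lambda>p. of_bool (W p)) ^ 2 ^ card U
    \<le> avg (U \<rightarrow>\<^sub>E V) (\<lambda>f. avg (I \<rightarrow>\<^sub>E V) (\<lambda>p. of_bool (\<forall>s \<in> transversals I p \<psi> U f. W s)))"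
  using assms
proof (induction U)
  case empty
  have "avg (I \<rightarrow>\<^sub>E V) (\<lambda>p. of_bool (W p))
      = avg (I \<rightarrow>\<^sub>E V) (\<lambda>p. of_bool (\<forall>s \<in> transversals I p \<psi> {} f. W s))" for f
    by (intro avg_cong) (simp add: transversals_empty)
  then show ?case by (simp add: avg_singleton)
next
  case (insert u U)
  have "avg (I \<rightarrow>\<^sub>E V) (\<lambda>p. of_bool (W p)) ^ 2 ^ card (insert u U)
      = (avg (I \<rightarrow>\<^sub>E V) (\<lambda>p. of_bool (W p)) ^ 2 ^ card U)\<^sup>2"
    using insert.hyps by (simp add: power_mult[symmetric] mult.commute)
  also have "\<dots> \<le> (avg (U \<rightarrow>\<^sub>E V) (\<lambda>f. avg (I \<rightarrow>\<^sub>E V)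
      (\<lambda>p. of_bool (\<forall>s \<in> transversals I p \<psi> U f. W s))))\<^sup>2"
    using insert by (intro power_mono) (simp_all add: avg_nonneg)
  also have "\<dots> \<le> avg (insert u U \<rightarrow>\<^sub>E V) (\<lambda>f. avg (I \<rightarrow>\<^sub>E V)
      (\<lambda>p. of_bool (\<forall>s \<in> transversals I p \<psi> (insert u U) f. W s)))"
    using insert by (intro transversals_density_square_le) auto
  finally show ?case .
qed

section \<open>Functions that are injective and avoid a set\<close>

lemma repeated_value_density:
  fixes U :: "'u set" and V W :: "'v set"
  assumes fin: "finite U" "finite V" "finite W" and "V \<noteq> {}" "u \<in> U"
  shows "avg (U \<rightarrow>\<^sub>E V) (\<lambda>f. of_bool (f u \<in> f ` (U - {u}) \<union> W))
    \<le> real (card U + card W) / real (card V)"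
proof -
  have "avg (U \<rightarrow>\<^sub>E V) (\<lambda>f. of_bool (f u \<in> f ` (U - {u}) \<union> W)) =
    avg (U - {u} \<rightarrow>\<^sub>E V) (\<lambda>f. avg V (\<lambda>v. of_bool (v \<in> f ` (U - {u}) \<union> W)))"
    using avg_PiE_insert[of u "U - {u}" V] \<open>u \<in> U\<close> by (simp add: insert_absorb avg_swap[of V])
  also have "\<dots> \<le> real (card U + card W) / real (card V)"
  proof (rule avg_le)
    fix f :: "'u \<Rightarrow> 'v"
    have "card {v \<in> V. v \<in> f ` (U - {u}) \<union> W} \<le> card (f ` (U - {u}) \<union> W)"
      using fin by (intro card_mono) auto
    also have "\<dots> \<le> card (U - {u}) + card W"
      using fin by (intro order.trans[OF card_Un_le] add_right_mono card_image_le) auto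
    also have "\<dots> \<le> card U + card W" using fin by (simp add: card_mono)
    finally show "avg V (\<lambda>v. of_bool (v \<in> f ` (U - {u}) \<union> W))
      \<le> real (card U + card W) / real (card V)"
      unfolding avg_of_bool[OF fin(2)] by (intro divide_right_mono) auto
  qed (use assms in \<open>simp_all add: PiE_eq_empty_iff finite_PiE\<close>)
  finally show ?thesis .
qed

lemma not_inj_avoiding_density:
  fixes U :: "'u set" and V W :: "'v set"
  assumes fin: "finite U" "finite V" "finite W" and "V \<noteq> {}"
  shows "avg (U \<rightarrow>\<^sub>E V) (\<lambda>f. of_bool (\<not> (inj_on f U \<and> f ` U \<inter> W = {})))
    \<le> real (card U * (card U + card W)) / real (card V)"
proof -
  define repeats where "repeats f u \<longleftrightarrow> f u \<in> f ` (U - {u}) \<union> W" for f :: "'u \<Rightarrow> 'v" and u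
  have "avg (U \<rightarrow>\<^sub>E V) (\<lambda>f. of_bool (\<not> (inj_on f U \<and> f ` U \<inter> W = {})))
      \<le> avg (U \<rightarrow>\<^sub>E V) (\<lambda>f. \<Sum>u\<in>U. of_bool (repeats f u))"
  proof (rule avg_mono)
    fix f :: "'u \<Rightarrow> 'v"
    show "of_bool (\<not> (inj_on f U \<and> f ` U \<inter> W = {})) \<le> (\<Sum>u\<in>U. of_bool (repeats f u) :: real)"
    proof (cases "inj_on f U \<and> f ` U \<inter> W = {}")
      case False
      then obtain u where "u \<in> U" "repeats f u"
        unfolding inj_on_def repeats_def by fastforce
      then have "1 \<le> (\<Sum>u\<in>U. of_bool (repeats f u) :: real)"
        using member_le_sum[of u U "\<lambda>u. of_bool (repeats f u) :: real"] fin by auto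
      then show ?thesis using False by simp
    qed (simp add: sum_nonneg)
  qed
  also have "\<dots> \<le> (\<Sum>u\<in>U. real (card U + card W) / real (card V))"
    unfolding avg_sum repeats_def by (intro sum_mono repeated_value_density assms)
  finally show ?thesis by (simp add: field_simps)
qed

section \<open>Walk densities\<close>

locale nonempty_graph = pair_graph G for G :: "'v pair_pre_digraph" +
  assumes verts_ne: "pverts G \<noteq> {}"
begin

abbreviation "V \<equiv> pverts G"

abbreviation "mean \<equiv> avg V"

definition adj :: "'v \<Rightarrow> 'v \<Rightarrow> real" where
  "adj x y = of_bool ((x, y) \<in> parcs G)"

text \<open>\<open>walks k x y\<close> is the density of the walks from \<open>x\<close> to \<open>y\<close> with \<open>k\<close> interior vertices.\<close>

primrec walks :: "nat \<Rightarrow> 'v \<Rightarrow> 'v \<Rightarrow> real" where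
  "walks 0 x y = adj x y"
| "walks (Suc k) x y = mean (\<lambda>z. adj x z * walks k z y)"

abbreviation "codeg \<equiv> walks (Suc 0)"

text \<open>Again the index counts interior vertices: \<open>closed_walks k\<close> concerns length \<open>k + 1\<close>.\<close>

definition closed_walks :: "nat \<Rightarrow> real" where
  "closed_walks k = mean (\<lambda>x. walks k x x)"

lemma arc_verts: "(a, b) \<in> parcs G \<Longrightarrow> a \<in> V \<and> b \<in> V"
  using in_arcsD1 in_arcsD2 by blast

lemma mean_const [simp]: "mean (\<lambda>_. c) = c"
  using pair_finite_verts verts_ne by (simp add: avg_const)

lemma adj_nonneg [simp]: "0 \<le> adj x y" and adj_le_1 [simp]: "adj x y \<le> 1"
  by (simp_all add: adj_def)

lemma adj_sym: "adj x y = adj y x"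
  using arcs_symmetric by (auto simp: adj_def)

lemma walks_nonneg [simp]: "0 \<le> walks k x y"
  by (induction k arbitrary: x) (auto intro!: avg_nonneg)

lemma walks_le_1 [simp]: "walks k x y \<le> 1"
proof (induction k arbitrary: x)
  case (Suc k)
  show ?case
    using pair_finite_verts verts_ne by (auto intro!: avg_le mult_le_one Suc.IH)
qed simp

lemma closed_walks_nonneg: "0 \<le> closed_walks k"
  by (simp add: closed_walks_def avg_nonneg)

lemma walks_add: "walks (Suc (j + k)) x y = mean (\<lambda>z. walks j x z * walks k z y)"
proof (induction j arbitrary: x)
  case (Suc j)
  have "walks (Suc (Suc j + k)) x y = mean (\<lambda>w. mean (\<lambda>z. adj x w * walks j w z * walks k z y))"
    by (simp add: Suc.IH[simplified] avg_mult_left[symmetric] mult.assoc)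
  also have "\<dots> = mean (\<lambda>z. mean (\<lambda>w. adj x w * walks j w z * walks k z y))" by (rule avg_swap)
  finally show ?case by (simp add: avg_mult_right)
qed simp

lemma walks_Suc_right: "walks (Suc k) x y = mean (\<lambda>z. walks k x z * adj z y)"
  using walks_add[of k 0 x y] by simp

lemma walks_sym: "walks k x y = walks k y x"
proof (induction k arbitrary: x y)
  case (Suc k)
  have "walks (Suc k) x y = mean (\<lambda>z. walks k y z * adj z x)"
    by (simp add: Suc.IH[of _ y] adj_sym[of x] mult.commute)
  then show ?case by (simp only: walks_Suc_right)
qed (simp add: adj_sym)

lemma walks_Suc_Suc:
  "walks (Suc (Suc k)) x y = mean (\<lambda>p. mean (\<lambda>q. adj x p * adj q y * walks k p q))"
  by (subst walks.simps(2))
    (simp add: walks_Suc_right avg_mult_left[symmetric] mult_ac del: walks.simps(2))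

declare walks.simps(2) [simp del]

lemma codeg_eq: "codeg x y = mean (\<lambda>z. adj x z * adj z y)"
  by (simp add: walks.simps(2))

lemma mean_codeg_right: "mean (\<lambda>p. adj x p * codeg p y) = walks 2 x y"
  by (simp add: numeral_2_eq_2 walks.simps(2)[of "Suc 0"])

lemma mean_adj_adj_adj: "mean (\<lambda>p. mean (\<lambda>q. adj x p * adj p q * adj q y)) = walks 2 x y"
  by (simp add: mean_codeg_right[symmetric] codeg_eq avg_mult_left mult.assoc)

lemma mean_codeg_between: "mean (\<lambda>p. mean (\<lambda>q. adj x p * adj q y * codeg p q)) = walks 3 x y"
  using walks_Suc_Suc[of "Suc 0" x y] by (simp add: numeral_3_eq_3)

lemma mean_adj_codeg_right:
  "mean (\<lambda>p. mean (\<lambda>q. adj x p * adj p q * codeg q y)) = walks 3 x y"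
  "mean (\<lambda>q. mean (\<lambda>p. adj x p * adj p q * codeg q y)) = walks 3 x y"
proof -
  show "mean (\<lambda>p. mean (\<lambda>q. adj x p * adj p q * codeg q y)) = walks 3 x y"
    by (simp add: mult.assoc avg_mult_left mean_codeg_right)
      (simp add: eval_nat_numeral walks.simps(2))
  then show "mean (\<lambda>q. mean (\<lambda>p. adj x p * adj p q * codeg q y)) = walks 3 x y"
    by (subst avg_swap)
qed

lemma mean_adj_codeg: "mean (\<lambda>x. mean (\<lambda>y. adj x y * codeg x y)) = closed_walks 2"
  by (simp add: closed_walks_def mean_codeg_right[symmetric] walks_sym)

lemmas mean_walks =
  mean_codeg_right mean_adj_adj_adj mean_codeg_between mean_adj_codeg_right mean_adj_codeg

lemma mean_closed_walks2:
  "mean (\<lambda>x. mean (\<lambda>y. walks j x y * walks k y x)) = closed_walks (Suc (j + k))"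
  by (simp add: closed_walks_def walks_add)

lemma mean_closed_walks3:
  "mean (\<lambda>x. mean (\<lambda>y. mean (\<lambda>z. walks i x y * walks j y z * walks k z x)))
    = closed_walks (i + j + k + 2)"
  using mean_closed_walks2[of i "Suc (j + k)"]
  by (simp add: walks_add avg_mult_left mult.assoc add_ac)

lemma mean_closed_walks4:
  "mean (\<lambda>x. mean (\<lambda>y. mean (\<lambda>z. mean (\<lambda>w. walks i x y * walks j y z * walks k z w * walks l w x))))
    = closed_walks (i + j + k + l + 3)"
  using mean_closed_walks3[of i j "Suc (k + l)"]
  by (simp add: walks_add avg_mult_left mult.assoc add_ac numeral_3_eq_3)

definition is_walk :: "nat \<Rightarrow> 'v \<Rightarrow> 'v \<Rightarrow> (nat \<Rightarrow> 'v) \<Rightarrow> bool" where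
  "is_walk k a b p \<longleftrightarrow>
     (\<forall>i\<le>k. ((p(0 := a, Suc k := b)) i, (p(0 := a, Suc k := b)) (Suc i)) \<in> parcs G)"

lemma is_walk_Suc:
  "is_walk (Suc k) a b (p(Suc k := z)) \<longleftrightarrow> is_walk k a z p \<and> (z, b) \<in> parcs G"
proof -
  have "(\<forall>i\<le>Suc k. P i) \<longleftrightarrow> (\<forall>i\<le>k. P i) \<and> P (Suc k)" for P
    by (metis le_Suc_eq order_refl)
  moreover have "(p(Suc k := z, 0 := a, Suc (Suc k) := b)) i = (p(0 := a, Suc k := z)) i"
    if "i \<le> Suc k" for i
    using that by simp
  ultimately show ?thesis unfolding is_walk_def by simp
qed

lemma walks_eq_avg: "walks k a b = avg ({1..k} \<rightarrow>\<^sub>E V) (\<lambda>p. of_bool (is_walk k a b p))"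
proof (induction k arbitrary: b)
  case 0
  show ?case by (simp add: avg_singleton is_walk_def adj_def)
next
  case (Suc k)
  have "walks (Suc k) a b = mean (\<lambda>z. avg ({1..k} \<rightarrow>\<^sub>E V) (\<lambda>p. of_bool (is_walk k a z p) * adj z b))"
    by (simp add: walks_Suc_right Suc.IH avg_mult_right)
  also have "\<dots> = avg (insert (Suc k) {1..k} \<rightarrow>\<^sub>E V) (\<lambda>p. of_bool (is_walk (Suc k) a b p))"
    by (subst avg_PiE_insert) (simp_all add: is_walk_Suc adj_def of_bool_conj)
  finally show ?case by (simp add: atLeastAtMostSuc_conv)
qed

lemma closed_walks_le:
  assumes "R \<subseteq> parcs G" and few: "real (card R) \<le> \<xi> * real (card V) ^ 2"
    and other: "\<And>a b. (a, b) \<in> parcs G - R \<Longrightarrow> walks k a b \<le> \<xi>" and "0 \<le> \<xi>"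
  shows "closed_walks (Suc k) \<le> 2 * \<xi>"
proof -
  have "closed_walks (Suc k) = mean (\<lambda>a. mean (\<lambda>b. adj a b * walks k a b))"
    using mean_closed_walks2[of 0 k] by (simp add: walks_sym)
  also have "\<dots> \<le> mean (\<lambda>a. mean (\<lambda>b. of_bool ((a, b) \<in> R) + \<xi>))"
  proof (intro avg_mono)
    fix a b
    consider "(a, b) \<in> R" | "(a, b) \<in> parcs G - R" | "(a, b) \<notin> parcs G" by blast
    then show "adj a b * walks k a b \<le> of_bool ((a, b) \<in> R) + \<xi>"
    proof cases
      case 1
      have "adj a b * walks k a b \<le> 1" by (simp add: mult_le_one)
      with 1 \<open>0 \<le> \<xi>\<close> show ?thesis by (simp del: walks_le_1)
    qed (use other[of a b] \<open>0 \<le> \<xi>\<close> in \<open>simp_all add: adj_def\<close>)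
  qed
  also have "\<dots> = mean (\<lambda>a. mean (\<lambda>b. of_bool ((a, b) \<in> R))) + \<xi>" by (simp add: avg_add)
  also have "mean (\<lambda>a. mean (\<lambda>b. of_bool ((a, b) \<in> R))) = real (card R) / real (card V) ^ 2"
  proof -
    have "(\<Sum>a\<in>V. \<Sum>b\<in>V. of_bool ((a, b) \<in> R)) = (\<Sum>p\<in>V \<times> V. of_bool (p \<in> R) :: real)"
      by (simp only: sum.cartesian_product split_def prod.collapse)
    also have "\<dots> = real (card (V \<times> V \<inter> R))"
      using pair_finite_verts by (simp add: Int_def)
    also have "V \<times> V \<inter> R = R" using assms(1) arc_verts by auto
    finally show ?thesis
      by (simp only: avg_def sum_divide_distrib[symmetric] divide_divide_eq_left power2_eq_square)
  qed
  also have "real (card R) / real (card V) ^ 2 \<le> \<xi>"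
    using few verts_ne by (subst pos_divide_le_eq) (simp_all add: card_gt_0_iff)
  finally show ?thesis by simp
qed

end

section \<open>Minimum degree above a quarter\<close>

locale dense_graph = nonempty_graph G for G :: "'v pair_pre_digraph" +
  fixes \<alpha> :: real
  assumes \<alpha>_pos: "0 < \<alpha>"
    and min_degree: "v \<in> pverts G \<Longrightarrow> (1 / 4 + \<alpha>) * real (card (pverts G)) \<le> real (out_degree G v)"
begin

lemma mean_adj_ge: "x \<in> V \<Longrightarrow> 1 / 4 + \<alpha> \<le> mean (adj x)"
proof -
  assume "x \<in> V"
  have "out_arcs G x = Pair x ` {y \<in> V. (x, y) \<in> parcs G}"
    using in_arcsD2 by (auto simp: out_arcs_def)
  then have "out_degree G x = card {y \<in> V. (x, y) \<in> parcs G}"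
    by (simp add: out_degree_def card_image inj_on_def)
  then show ?thesis
    using min_degree[OF \<open>x \<in> V\<close>] verts_ne
    by (simp add: adj_def[abs_def] avg_of_bool pos_le_divide_eq card_gt_0_iff)
qed

lemma mean_adj_ge_quarter: "x \<in> V \<Longrightarrow> 1 / 4 \<le> mean (adj x)"
  using mean_adj_ge[of x] \<alpha>_pos by simp

lemma \<alpha>_le_1: "\<alpha> \<le> 1"
proof -
  obtain x where "x \<in> V" using verts_ne by auto
  then have "1 / 4 + \<alpha> \<le> mean (adj x)" by (rule mean_adj_ge)
  also have "\<dots> \<le> 1" using verts_ne by (intro avg_le) auto
  finally show ?thesis by simp
qed

lemma codeg_square:
  assumes "x \<in> V" "y \<in> V"
  shows "(codeg x y)\<^sup>2 / 16 \<le> walks 3 x y"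
proof -
  define t where "t z = adj x z * adj z y" for z
  have t: "0 \<le> t z" "t z \<le> adj x z" "t z \<le> adj z y" for z
    by (auto simp: t_def adj_def)
  have "codeg x y / 4 = mean (\<lambda>p. t p * (1 / 4))"
    by (subst avg_mult_right) (simp add: codeg_eq t_def[abs_def])
  also have "\<dots> \<le> mean (\<lambda>p. t p * mean (adj p))"
    by (intro avg_mono mult_left_mono mean_adj_ge_quarter) (auto simp: t)
  also have "\<dots> = mean (\<lambda>z. mean (\<lambda>p. t p * adj p z))"
    by (subst avg_swap) (simp add: avg_mult_left)
  finally have "(codeg x y / 4)\<^sup>2 \<le> (mean (\<lambda>z. mean (\<lambda>p. t p * adj p z)))\<^sup>2"
    by (rule power_mono) simp
  also have "\<dots> \<le> mean (\<lambda>z. (mean (\<lambda>p. t p * adj p z))\<^sup>2)" by (rule avg_square)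
  also have "\<dots> = mean (\<lambda>z. mean (\<lambda>p. mean (\<lambda>q. t p * t q * (adj p z * adj z q))))"
    by (simp add: power2_eq_square avg_mult_left[symmetric] avg_mult_right[symmetric]
        adj_sym[of z for z] mult_ac)
  also have "\<dots> = mean (\<lambda>p. mean (\<lambda>q. mean (\<lambda>z. t p * t q * (adj p z * adj z q))))"
    by (subst avg_swap) (rule avg_cong, rule avg_swap)
  also have "\<dots> = mean (\<lambda>p. mean (\<lambda>q. t p * t q * codeg p q))"
    by (simp add: avg_mult_left codeg_eq)
  also have "\<dots> \<le> mean (\<lambda>p. mean (\<lambda>q. adj x p * adj q y * codeg p q))"
    by (intro avg_mono mult_mono) (auto simp: t)
  finally show ?thesis by (simp add: mean_walks power_divide)
qed

lemma codeg_le: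
  assumes "x \<in> V" "y \<in> V" "walks 3 x y \<le> \<xi>\<^sup>2 / 16" "0 \<le> \<xi>"
  shows "codeg x y \<le> \<xi>"
proof -
  have "(codeg x y)\<^sup>2 \<le> \<xi>\<^sup>2" using codeg_square[OF assms(1,2)] assms(3) by linarith
  then show ?thesis by (rule power2_le_imp_le) fact
qed

text \<open>Bonferroni's inequality for four neighbourhoods of density at least \<open>1/4 + \<alpha>\<close>.\<close>

lemma four_vertices:
  assumes "a \<in> V" "b \<in> V" "c \<in> V" "d \<in> V"
  shows "4 * \<alpha> \<le> codeg a b + codeg a c + codeg a d + codeg b c + codeg b d + codeg c d"
proof -
  have "4 * \<alpha> + 1 \<le> mean (\<lambda>z. adj a z + adj b z + adj c z + adj d z)"
    using assms[THEN mean_adj_ge] by (simp add: avg_add)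
  also have "\<dots> \<le> mean (\<lambda>z. adj a z * adj z b + adj a z * adj z c + adj a z * adj z d
       + adj b z * adj z c + adj b z * adj z d + adj c z * adj z d + 1)"
    unfolding adj_sym[of _ b] adj_sym[of _ c] adj_sym[of _ d]
    by (intro avg_mono) (simp add: adj_def)
  finally show ?thesis by (simp add: avg_add codeg_eq)
qed

lemma four_vertices_weighted:
  assumes "a \<in> V" "b \<in> V" "c \<in> V" "d \<in> V" "0 \<le> g"
    and "g \<le> g\<^sub>a\<^sub>b" "g \<le> g\<^sub>a\<^sub>c" "g \<le> g\<^sub>a\<^sub>d" "g \<le> g\<^sub>b\<^sub>c" "g \<le> g\<^sub>b\<^sub>d" "g \<le> g\<^sub>c\<^sub>d"
  shows "4 * \<alpha> * g \<le> g\<^sub>a\<^sub>b * codeg a b + g\<^sub>a\<^sub>c * codeg a c + g\<^sub>a\<^sub>d * codeg a d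
    + g\<^sub>b\<^sub>c * codeg b c + g\<^sub>b\<^sub>d * codeg b d + g\<^sub>c\<^sub>d * codeg c d"
proof -
  have "4 * \<alpha> * g \<le> (codeg a b + codeg a c + codeg a d + codeg b c + codeg b d + codeg c d) * g"
    using assms by (intro mult_right_mono four_vertices)
  also have "\<dots> = g * codeg a b + g * codeg a c + g * codeg a d
    + g * codeg b c + g * codeg b d + g * codeg c d"
    by (simp add: algebra_simps)
  also have "\<dots> \<le> g\<^sub>a\<^sub>b * codeg a b + g\<^sub>a\<^sub>c * codeg a c + g\<^sub>a\<^sub>d * codeg a d
    + g\<^sub>b\<^sub>c * codeg b c + g\<^sub>b\<^sub>d * codeg b d + g\<^sub>c\<^sub>d * codeg c d"
    using assms by (intro add_mono mult_right_mono) auto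
  finally show ?thesis .
qed

section \<open>Pentagons\<close>

lemma triangles_product_le:
  "4 * \<alpha> * (walks 2 v v * walks 2 w w) \<le> 2 * closed_walks 2 + 4 * walks 3 v w"
proof -
  define T where "T v a b = adj v a * adj a b * adj b v" for v a b
  have "4 * \<alpha> * (walks 2 v v * walks 2 w w) =
      mean (\<lambda>a. mean (\<lambda>b. mean (\<lambda>c. mean (\<lambda>d. 4 * \<alpha> * (T v a b * T w c d)))))"
    by (simp add: T_def avg_mult_left avg_mult_right mean_walks)
  also have "\<dots> \<le> mean (\<lambda>a. mean (\<lambda>b. mean (\<lambda>c. mean (\<lambda>d. adj a b * codeg a b
      + adj v a * adj c w * codeg a c + adj v a * adj d w * codeg a d
      + adj v b * adj c w * codeg b c + adj v b * adj d w * codeg b d + adj c d * codeg c d))))"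
    by (intro avg_mono four_vertices_weighted)
      (auto simp: T_def adj_def simp flip: of_bool_conj intro: arcs_symmetric)
  also have "\<dots> = 2 * closed_walks 2 + 4 * walks 3 v w"
    by (simp add: avg_add avg_mult_left mean_walks)
  finally show ?thesis .
qed

lemma triangles_le:
  assumes "w \<in> V"
  shows "\<alpha> * walks 2 v v \<le> closed_walks 2 + 4 * walks 3 v w + walks 2 v v * walks 2 w w"
proof -
  define T where "T a b = adj v a * adj a b * adj b v" for a b
  have "\<alpha> * walks 2 v v = 4 * \<alpha> * (walks 2 v v * (1 / 4))" by simp
  also have "\<dots> \<le> 4 * \<alpha> * (walks 2 v v * mean (adj w))"
    using \<alpha>_pos assms by (intro mult_left_mono mean_adj_ge_quarter) auto
  also have "\<dots> = mean (\<lambda>a. mean (\<lambda>b. mean (\<lambda>c. 4 * \<alpha> * (T a b * adj w c))))"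
    by (simp add: T_def avg_mult_left avg_mult_right mean_walks)
  also have "\<dots> \<le> mean (\<lambda>a. mean (\<lambda>b. mean (\<lambda>c. adj a b * codeg a b
      + adj v a * adj c w * codeg a c + adj v b * adj b a * codeg a w
      + adj v b * adj c w * codeg b c + adj v a * adj a b * codeg b w
      + T a b * adj w c * codeg c w)))"
    by (intro avg_mono four_vertices_weighted assms)
      (auto simp: T_def adj_def simp flip: of_bool_conj intro: arcs_symmetric)
  also have "\<dots> = closed_walks 2 + 4 * walks 3 v w + walks 2 v v * walks 2 w w"
  proof -
    have "mean (\<lambda>a. mean (\<lambda>b. mean (\<lambda>c. T a b * adj w c * codeg c w))) = walks 2 v v * walks 2 w w"
      by (simp add: mult.assoc[of "T _ _"] avg_mult_left avg_mult_right mean_codeg_right)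
        (simp add: T_def[abs_def] mean_walks)
    then show ?thesis by (simp add: avg_add mean_walks)
  qed
  finally show ?thesis .
qed

lemma triangles_few:
  assumes "w \<in> V" "walks 3 v w \<le> \<xi>" "closed_walks 2 \<le> 2 * \<xi>"
  shows "walks 2 v v \<le> 8 * \<xi> / \<alpha>\<^sup>2"
proof -
  have "0 \<le> \<xi>" using assms(2) walks_nonneg[of 3 v w] by linarith
  have "walks 2 v v * walks 2 w w \<le> 2 * \<xi> / \<alpha>"
    using triangles_product_le[of v w] assms \<alpha>_pos by (simp add: pos_le_divide_eq mult_ac)
  then have "\<alpha> * walks 2 v v \<le> 6 * \<xi> + 2 * \<xi> / \<alpha>"
    using triangles_le[OF assms(1), of v] assms by linarith
  also have "6 * \<xi> \<le> 6 * \<xi> / \<alpha>"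
    using \<open>0 \<le> \<xi>\<close> \<alpha>_pos \<alpha>_le_1 by (simp add: pos_le_divide_eq mult_left_le)
  finally show ?thesis using \<alpha>_pos by (simp add: field_simps power2_eq_square)
qed

definition common_edges :: "'v \<Rightarrow> 'v \<Rightarrow> 'v \<Rightarrow> real" where
  "common_edges x y w = mean (\<lambda>z. adj x z * adj z y * codeg z w)"

lemma common_edges_le:
  assumes "q \<in> V" and common: "\<alpha> \<le> codeg p q"
  shows "4 * \<alpha>\<^sup>2 * common_edges x y z
    \<le> closed_walks 2 + walks 3 x p + walks 3 x q + 2 * walks 3 z q + walks 2 q q"
proof -
  define T where "T r s = adj x r * adj r y * (adj r s * adj s z)" for r s
  have ce: "common_edges x y z = mean (\<lambda>r. mean (T r))"
    by (simp add: common_edges_def T_def[abs_def] codeg_eq avg_mult_left)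
  have "0 \<le> common_edges x y z" by (simp add: common_edges_def avg_nonneg)
  then have "4 * \<alpha> * (common_edges x y z * \<alpha>) \<le> 4 * \<alpha> * (common_edges x y z * codeg p q)"
    using common \<alpha>_pos by (intro mult_left_mono) auto
  also have "\<dots> = mean (\<lambda>r. mean (\<lambda>s. mean (\<lambda>t. 4 * \<alpha> * (T r s * (adj p t * adj t q)))))"
    by (simp add: ce codeg_eq avg_mult_left avg_mult_right)
  also have "\<dots> \<le> mean (\<lambda>r. mean (\<lambda>s. mean (\<lambda>t. adj r s * codeg r s
      + adj x r * adj t p * codeg r t + adj z s * adj s r * codeg r q
      + adj z s * adj t q * codeg s t + adj x r * adj r s * codeg s q
      + adj q t * codeg t q)))"
    by (intro avg_mono four_vertices_weighted assms)
      (auto simp: T_def adj_def simp flip: of_bool_conj intro: arcs_symmetric)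
  also have "\<dots> = closed_walks 2 + walks 3 x p + walks 3 x q + 2 * walks 3 z q + walks 2 q q"
    by (simp add: avg_add mean_walks)
  finally show ?thesis by (simp add: power2_eq_square mult_ac)
qed

lemma cube_le_common_edges:
  assumes "v4 \<in> V" and common: "\<alpha> \<le> codeg v0 v2" "\<alpha> \<le> codeg v1 v3"
  shows "\<alpha> ^ 3 \<le> walks 3 v0 v1 + walks 3 v0 v4 + walks 3 v3 v4 + walks 2 v4 v4
    + common_edges v2 v0 v4 + common_edges v1 v3 v4"
proof -
  define S where "S x y z = adj x z * adj z y" for x y z
  have "\<alpha> ^ 3 = 4 * \<alpha> * (\<alpha> * \<alpha> * (1 / 4))" by (simp add: power3_eq_cube)
  also have "\<dots> \<le> 4 * \<alpha> * (codeg v0 v2 * codeg v1 v3 * mean (adj v4))"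
    using \<alpha>_pos common assms(1) by (intro mult_left_mono mult_mono mean_adj_ge_quarter) auto
  also have "\<dots> = mean (\<lambda>z. mean (\<lambda>w. mean (\<lambda>s. 4 * \<alpha> * (S v0 v2 z * S v1 v3 w * adj v4 s))))"
    by (simp add: S_def codeg_eq avg_mult_left avg_mult_right)
  also have "\<dots> \<le> mean (\<lambda>z. mean (\<lambda>w. mean (\<lambda>s. adj v0 z * adj w v1 * codeg z w
      + adj v0 z * adj s v4 * codeg z s + adj v2 z * adj z v0 * codeg z v4
      + adj v3 w * adj s v4 * codeg w s + adj v1 w * adj w v3 * codeg w v4
      + adj v4 s * codeg s v4)))"
    by (intro avg_mono four_vertices_weighted assms)
      (auto simp: S_def adj_def simp flip: of_bool_conj intro: arcs_symmetric)
  also have "\<dots> = walks 3 v0 v1 + walks 3 v0 v4 + walks 3 v3 v4 + walks 2 v4 v4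
    + common_edges v2 v0 v4 + common_edges v1 v3 v4"
    by (simp add: avg_add mean_walks common_edges_def)
  finally show ?thesis .
qed

text \<open>
  The common neighbourhoods of \<open>v0, v2\<close> and of \<open>v1, v3\<close> and the neighbourhood of \<open>v4\<close> contain only
  few pairs with many common neighbours. Hence \<open>v4\<close> must share many neighbours with one of the two
  common neighbourhoods, which is impossible by the same argument with \<open>v0\<close> or \<open>v3\<close> as fourth
  vertex.
\<close>

lemma pentagon_two_diagonals:
  assumes V: "v0 \<in> V" "v1 \<in> V" "v2 \<in> V" "v3 \<in> V" "v4 \<in> V"
    and sparse: "walks 3 v0 v1 \<le> \<xi>" "walks 3 v1 v2 \<le> \<xi>" "walks 3 v2 v3 \<le> \<xi>" "walks 3 v3 v4 \<le> \<xi>"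
      "walks 3 v4 v0 \<le> \<xi>" "closed_walks 2 \<le> 2 * \<xi>"
    and common: "\<alpha> \<le> codeg v0 v2" "\<alpha> \<le> codeg v1 v3"
  shows "\<alpha> ^ 7 \<le> 18 * \<xi>"
proof -
  define \<zeta> where "\<zeta> = \<xi> / \<alpha>\<^sup>2"
  have "0 \<le> \<xi>" using sparse(1) walks_nonneg[of 3 v0 v1] by linarith
  have le_divide: "t \<le> t / \<alpha>\<^sup>2" if "0 \<le> t" for t
    using that \<alpha>_pos \<alpha>_le_1 by (simp add: pos_le_divide_eq mult_left_le power_le_one)
  have "\<xi> \<le> \<zeta>" "\<zeta> \<le> \<zeta> / \<alpha>\<^sup>2"
    using le_divide[of \<xi>] le_divide[of \<zeta>] \<open>0 \<le> \<xi>\<close> by (simp_all add: \<zeta>_def)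
  have sym: "walks 3 v1 v0 = walks 3 v0 v1" "walks 3 v2 v1 = walks 3 v1 v2"
    "walks 3 v4 v3 = walks 3 v3 v4" "walks 3 v0 v4 = walks 3 v4 v0" by (rule walks_sym)+
  have triangles: "walks 2 v0 v0 \<le> 8 * \<zeta>" "walks 2 v3 v3 \<le> 8 * \<zeta>" "walks 2 v4 v4 \<le> 8 * \<zeta>"
    using triangles_few[of v1 v0 \<xi>] triangles_few[of v4 v3 \<xi>] triangles_few[of v0 v4 \<xi>] V sparse
    by (simp_all add: \<zeta>_def)
  have "4 * \<alpha>\<^sup>2 * common_edges v2 v0 v4 \<le> 14 * \<zeta>"
    using common_edges_le[OF V(4) common(2), of v2 v0 v4] sparse sym triangles \<open>\<xi> \<le> \<zeta>\<close> by linarith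
  moreover have "\<alpha> \<le> codeg v2 v0" using common(1) by (simp add: walks_sym)
  then have "4 * \<alpha>\<^sup>2 * common_edges v1 v3 v4 \<le> 14 * \<zeta>"
    using common_edges_le[OF V(1), of v2 v1 v3 v4] sparse sym triangles \<open>\<xi> \<le> \<zeta>\<close> by linarith
  ultimately have "common_edges v2 v0 v4 \<le> 7 / 2 * (\<zeta> / \<alpha>\<^sup>2)"
    "common_edges v1 v3 v4 \<le> 7 / 2 * (\<zeta> / \<alpha>\<^sup>2)"
    using \<alpha>_pos by (simp_all add: field_simps)
  then have "\<alpha> ^ 3 \<le> 18 * (\<zeta> / \<alpha>\<^sup>2)"
    using cube_le_common_edges[OF V(5) common] sparse sym triangles \<open>\<xi> \<le> \<zeta>\<close> \<open>\<zeta> \<le> \<zeta> / \<alpha>\<^sup>2\<close> by linarith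
  then show ?thesis
    using \<alpha>_pos by (simp add: \<zeta>_def field_simps eval_nat_numeral)
qed

lemma pentagon_bound:
  assumes V: "\<And>i. v i \<in> V" and period: "\<And>i. v (i + 5) = v i"
    and walks3: "\<And>i. walks 3 (v i) (v (Suc i)) \<le> \<xi>"
    and codeg: "\<And>i. codeg (v i) (v (Suc i)) \<le> \<xi>"
    and "closed_walks 2 \<le> 2 * \<xi>"
  shows "\<alpha> ^ 7 \<le> 18 * \<xi>"
proof (rule ccontr)
  assume large: "\<not> \<alpha> ^ 7 \<le> 18 * \<xi>"
  have "\<alpha> ^ 7 \<le> \<alpha> ^ 1" by (rule power_decreasing) (use \<alpha>_pos \<alpha>_le_1 in auto)
  then have "3 * \<xi> < \<alpha>" using large \<alpha>_pos by simp
  define diagonal where "diagonal i \<longleftrightarrow> \<alpha> \<le> codeg (v i) (v (i + 2))" for i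
  have diagonal_period: "diagonal (i + 5) \<longleftrightarrow> diagonal i" for i
    using period[of i] period[of "i + 2"] by (simp add: diagonal_def add_ac)
  have not_both: "\<not> (diagonal i \<and> diagonal (Suc i))" for i
    using pentagon_two_diagonals[of "v i" "v (i + 1)" "v (i + 2)" "v (i + 3)" "v (i + 4)" \<xi>]
      large V walks3[of i] walks3[of "i + 1"] walks3[of "i + 2"] walks3[of "i + 3"]
      walks3[of "i + 4"] period[of i] assms(5)
    by (auto simp: diagonal_def eval_nat_numeral)
  have one_of_three: "diagonal i \<or> diagonal (i + 1) \<or> diagonal (i + 3)" for i
    using four_vertices[OF V V V V, of i "i + 1" "i + 2" "i + 3"] \<open>3 * \<xi> < \<alpha>\<close>
      codeg[of i] codeg[of "i + 1"] codeg[of "i + 2"] period[of i]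
      walks_sym[of "Suc 0" "v i" "v (i + 3)"]
    by (auto simp: diagonal_def eval_nat_numeral)
  \<comment> \<open>Modulo 5, a set without consecutive elements misses some triple \<open>i\<close>, \<open>i + 1\<close>, \<open>i + 3\<close>.\<close>
  show False
    using not_both[of 0] not_both[of 1] not_both[of 2] not_both[of 3] not_both[of 4]
      one_of_three[of 0] one_of_three[of 1] one_of_three[of 2] one_of_three[of 3] one_of_three[of 4]
      diagonal_period[of 0] diagonal_period[of 1] diagonal_period[of 2]
    by (simp add: eval_nat_numeral) blast
qed

section \<open>Odd closed walks\<close>

text \<open>
  Apply \<open>four_vertices\<close> to the first, second, fifth and sixth vertex of a closed walk: two of them
  have many common neighbours, and the resulting shortcut closes an odd walk that is shorter.
\<close>

lemma closed_walks_step: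
  "4 * \<alpha> * closed_walks (j + 5)
    \<le> 2 * closed_walks 2 + 2 * closed_walks (j + 3) + closed_walks 4 + closed_walks 6"
proof -
  have "4 * \<alpha> * closed_walks (j + 5) = mean (\<lambda>a. mean (\<lambda>b. mean (\<lambda>c. mean (\<lambda>d.
      4 * \<alpha> * (adj a b * walks 2 b c * adj c d * walks j d a)))))"
    using mean_closed_walks4[of 0 2 0 j] by (simp add: avg_mult_left add_ac)
  also \<comment> \<open>the ones let \<open>mult_mono\<close> compare factor by factor\<close>
  have "\<dots> \<le> mean (\<lambda>a. mean (\<lambda>b. mean (\<lambda>c. mean (\<lambda>d.
      (adj a b * 1 * 1 * 1) * codeg a b + (1 * 1 * adj c d * walks j d a) * codeg a c
      + (adj a b * walks 2 b c * adj c d * 1) * codeg a d + (1 * walks 2 b c * 1 * 1) * codeg b c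
      + (adj a b * 1 * 1 * walks j d a) * codeg b d + (1 * 1 * adj c d * 1) * codeg c d))))"
    by (intro avg_mono four_vertices_weighted mult_mono) (auto intro!: mult_nonneg_nonneg)
  also have "\<dots> = mean (\<lambda>a. mean (\<lambda>b. mean (\<lambda>c. mean (\<lambda>d. adj a b * codeg a b
      + codeg a c * adj c d * walks j d a + adj a b * walks 2 b c * adj c d * codeg d a
      + walks 2 b c * codeg c b + adj a b * codeg b d * walks j d a + adj c d * codeg c d))))"
    by (simp add: mult_ac walks_sym)
  also have "\<dots> = 2 * closed_walks 2 + 2 * closed_walks (j + 3) + closed_walks 4 + closed_walks 6"
    using mean_closed_walks3[of "Suc 0" 0 j] mean_closed_walks3[of 0 "Suc 0" j]
      mean_closed_walks2[of 2 "Suc 0"] mean_closed_walks4[of 0 2 0 "Suc 0"]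
    by (simp add: avg_add mean_adj_codeg add_ac eval_nat_numeral)
  finally show ?thesis .
qed

lemma closed_walks_bound:
  assumes "closed_walks 2 \<le> 2 * \<xi>" "closed_walks 4 \<le> 2 * \<xi>" "closed_walks 6 \<le> 2 * \<xi>"
  shows "closed_walks (6 + 2 * j) \<le> 2 * (2 / \<alpha>) ^ j * \<xi>"
proof (induction j)
  case (Suc j)
  have "0 \<le> \<xi>" using assms(1) closed_walks_nonneg[of 2] by simp
  have "1 \<le> (2 / \<alpha>) ^ j" using \<alpha>_pos \<alpha>_le_1 by (intro one_le_power) (simp add: pos_le_divide_eq)
  then have "\<xi> \<le> (2 / \<alpha>) ^ j * \<xi>" using \<open>0 \<le> \<xi>\<close> by (simp add: mult_le_cancel_right1)
  have "4 * \<alpha> * closed_walks (2 * j + 3 + 5)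
      \<le> 2 * closed_walks 2 + 2 * closed_walks (2 * j + 3 + 3) + closed_walks 4 + closed_walks 6"
    by (rule closed_walks_step)
  also have "\<dots> \<le> 16 * ((2 / \<alpha>) ^ j * \<xi>)"
  proof -
    have "closed_walks (2 * j + 3 + 3) \<le> 2 * ((2 / \<alpha>) ^ j * \<xi>)"
      using Suc.IH by (simp add: add_ac mult.assoc)
    then show ?thesis
      using assms \<open>0 \<le> \<xi>\<close> \<open>\<xi> \<le> (2 / \<alpha>) ^ j * \<xi>\<close> by linarith
  qed
  finally show ?case
    using \<alpha>_pos by (simp add: add_ac field_simps)
qed (use assms in simp)

definition nbhd_mean :: "'v \<Rightarrow> 'v \<Rightarrow> ('v \<Rightarrow> 'v \<Rightarrow> real) \<Rightarrow> real" where
  "nbhd_mean v w f = mean (\<lambda>s. mean (\<lambda>t. adj v s * adj w t * f s t))"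

text \<open>
  Being subadditive under concatenation of walks (\<open>shortfall_mult\<close>), the shortfalls add up
  along a chain of links.
\<close>

definition shortfall :: "real \<Rightarrow> nat \<Rightarrow> 'v \<Rightarrow> 'v \<Rightarrow> real" where
  "shortfall C k s t = max 0 (1 - C * walks k s t)"

lemma shortfall_nonneg [simp]: "0 \<le> shortfall C k s t"
  by (simp add: shortfall_def)

lemma shortfall_mult:
  assumes "0 \<le> C" "0 \<le> C'"
  shows "1 - C * walks j s t * (C' * walks k t r) \<le> shortfall C j s t + shortfall C' k t r"
proof -
  have "1 - x * y \<le> max 0 (1 - x) + max 0 (1 - y)" if "0 \<le> x" "0 \<le> y" for x y :: real
  proof (cases "x \<le> 1 \<and> y \<le> 1")
    case True
    then have "0 \<le> (1 - x) * (1 - y)" by simp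
    with True show ?thesis by (simp add: algebra_simps)
  next
    case False
    then have "min x y \<le> x * y"
      using that mult_right_mono[of 1 x y] mult_left_mono[of 1 y x] by (auto simp: min_def)
    then show ?thesis by (auto simp: min_def max_def split: if_splits)
  qed
  then show ?thesis using assms by (simp add: shortfall_def)
qed

lemma nbhd_mean_mono:
  "(\<And>s t. s \<in> V \<Longrightarrow> t \<in> V \<Longrightarrow> f s t \<le> g s t) \<Longrightarrow> nbhd_mean v w f \<le> nbhd_mean v w g"
  unfolding nbhd_mean_def by (intro avg_mono mult_left_mono) auto

lemma nbhd_mean_join:
  assumes "\<And>s t. 0 \<le> f s t" "\<And>t r. 0 \<le> g t r"
  shows "nbhd_mean v w (\<lambda>s r. mean (\<lambda>t. adj x t * (f s t + g t r)))
    \<le> nbhd_mean v x f + nbhd_mean x w g"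
proof -
  have "nbhd_mean v w (\<lambda>s r. mean (\<lambda>t. adj x t * (f s t + g t r)))
      \<le> mean (\<lambda>s. mean (\<lambda>r. mean (\<lambda>t. adj v s * adj x t * f s t + adj x t * adj w r * g t r)))"
    unfolding nbhd_mean_def avg_mult_left[symmetric]
  proof (intro avg_mono)
    fix s r t
    have "adj v s * adj w r * (adj x t * (f s t + g t r))
        = adj w r * (adj v s * adj x t * f s t) + adj v s * (adj x t * adj w r * g t r)"
      by (simp add: algebra_simps)
    also have "\<dots> \<le> adj v s * adj x t * f s t + adj x t * adj w r * g t r"
      using assms by (intro add_mono mult_left_le_one_le) auto
    finally show "adj v s * adj w r * (adj x t * (f s t + g t r))
      \<le> adj v s * adj x t * f s t + adj x t * adj w r * g t r" .
  qed
  also have "\<dots> = nbhd_mean v x f + nbhd_mean x w g"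
    unfolding nbhd_mean_def by (subst (2) avg_swap) (simp add: avg_add)
  finally show ?thesis .
qed

lemma shortfall_join:
  assumes "x \<in> V" "0 \<le> C" "0 \<le> C'"
  shows "shortfall (4 * C * C') (Suc (j + k)) s r
    \<le> 4 * mean (\<lambda>t. adj x t * (shortfall C j s t + shortfall C' k t r))"
proof -
  have "1 \<le> 4 * mean (adj x)" using mean_adj_ge_quarter[OF assms(1)] by simp
  also have "\<dots> \<le> 4 * mean (\<lambda>t. C * C' * (walks j s t * walks k t r)
      + adj x t * (shortfall C j s t + shortfall C' k t r))"
  proof (intro mult_left_mono avg_mono)
    fix t
    let ?W = "C * C' * (walks j s t * walks k t r)"
    have "1 \<le> ?W + (shortfall C j s t + shortfall C' k t r)"
      using shortfall_mult[OF assms(2,3), of j s t k r] by (simp add: mult_ac)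
    then have "adj x t * 1 \<le> adj x t * (?W + (shortfall C j s t + shortfall C' k t r))"
      by (rule mult_left_mono) simp
    also have "\<dots> \<le> ?W + adj x t * (shortfall C j s t + shortfall C' k t r)"
      unfolding distrib_left using assms by (intro add_right_mono mult_left_le_one_le) auto
    finally show "adj x t \<le> ?W + adj x t * (shortfall C j s t + shortfall C' k t r)" by simp
  qed simp
  also have "\<dots> = 4 * C * C' * walks (Suc (j + k)) s r
      + 4 * mean (\<lambda>t. adj x t * (shortfall C j s t + shortfall C' k t r))"
    by (simp add: avg_add avg_mult_left walks_add)
  finally show ?thesis
    by (simp add: shortfall_def avg_nonneg)
qed

lemma walks_link:
  assumes "s \<in> V" "r \<in> V"
  shows "\<alpha> / 4 \<le> codeg s r + walks 3 s r + walks 2 s s + walks 2 r r + 2 * walks 2 s r"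
proof -
  have "\<alpha> / 4 = 4 * \<alpha> * (1 / 4 * (1 / 4))" by simp
  also have "\<dots> \<le> 4 * \<alpha> * (mean (adj s) * mean (adj r))"
    using \<alpha>_pos assms[THEN mean_adj_ge_quarter] by (intro mult_left_mono mult_mono) auto
  also have "\<dots> = mean (\<lambda>p. mean (\<lambda>q. 4 * \<alpha> * (adj s p * adj r q)))"
    by (simp add: avg_mult_left avg_mult_right)
  also have "\<dots> \<le> mean (\<lambda>p. mean (\<lambda>q. adj s p * adj q r * codeg p q + adj s p * codeg p s
      + adj s p * codeg p r + adj r q * codeg q s + adj r q * codeg q r + 1 * codeg s r))"
    by (intro avg_mono four_vertices_weighted assms)
      (auto simp: adj_def simp flip: of_bool_conj intro: arcs_symmetric)
  also have "\<dots> = codeg s r + walks 3 s r + walks 2 s s + walks 2 r r + 2 * walks 2 s r"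
    by (simp add: avg_add mean_walks walks_sym[of 2 r s])
  finally show ?thesis .
qed

text \<open>
  Most pairs of neighbours \<open>s\<close> of \<open>v\<close> and \<open>r\<close> of \<open>w\<close> are joined by many walks of length 3 if the
  edge \<open>vw\<close> lies in few closed walks of length 5 and 7: the other terms in \<open>walks_link\<close> are then
  small on average. Concatenating these links along an odd closed walk of length \<open>g\<close> yields many
  closed walks of odd length \<open>3 g\<close>.
\<close>

lemma nbhd_mean_link_le:
  assumes "walks 3 v w \<le> \<xi>" "walks 5 v w \<le> \<xi>" "closed_walks 2 \<le> 2 * \<xi>"
  shows "nbhd_mean v w (shortfall (8 / \<alpha>) 2) \<le> 24 / \<alpha> * \<xi>"
proof -
  define error where "error s r = codeg s r + walks 3 s r + walks 2 s s + walks 2 r r" for s r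
  have "nbhd_mean v w (shortfall (8 / \<alpha>) 2) \<le> nbhd_mean v w (\<lambda>s r. 4 / \<alpha> * error s r)"
  proof (rule nbhd_mean_mono)
    fix s r assume "s \<in> V" "r \<in> V"
    have "4 / \<alpha> * (\<alpha> / 4) \<le> 4 / \<alpha> * (error s r + 2 * walks 2 s r)"
      using \<alpha>_pos walks_link[OF \<open>s \<in> V\<close> \<open>r \<in> V\<close>] by (intro mult_left_mono) (auto simp: error_def)
    moreover have "0 \<le> 4 / \<alpha> * error s r" using \<alpha>_pos by (simp add: error_def)
    ultimately show "shortfall (8 / \<alpha>) 2 s r \<le> 4 / \<alpha> * error s r"
      using \<alpha>_pos by (simp add: shortfall_def algebra_simps)
  qed
  also have "\<dots> = 4 / \<alpha> * mean (\<lambda>s. mean (\<lambda>r. adj v s * adj w r * error s r))"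
    by (simp add: nbhd_mean_def avg_mult_left[symmetric] mult_ac)
  also have "\<dots> \<le> 4 / \<alpha> * mean (\<lambda>s. mean (\<lambda>r. adj v s * adj r w * codeg s r
      + adj v s * adj r w * walks 3 s r + walks 2 s s + walks 2 r r))"
  proof (intro mult_left_mono avg_mono)
    fix s r
    have "adj v s * adj w r * t \<le> t" if "0 \<le> t" for t
      using that by (intro mult_left_le_one_le) (auto intro: mult_le_one)
    then show "adj v s * adj w r * error s r \<le> adj v s * adj r w * codeg s r
        + adj v s * adj r w * walks 3 s r + walks 2 s s + walks 2 r r"
      unfolding error_def distrib_left adj_sym[of r w] by (intro add_mono) auto
  qed (use \<alpha>_pos in simp)
  also have "\<dots> = 4 / \<alpha> * (walks 3 v w + walks 5 v w + 2 * closed_walks 2)"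
    using walks_Suc_Suc[of 3 v w]
    by (simp add: avg_add mean_walks closed_walks_def eval_nat_numeral)
  also have "\<dots> \<le> 4 / \<alpha> * (6 * \<xi>)" using assms \<alpha>_pos by (intro mult_left_mono) auto
  finally show ?thesis by simp
qed

lemma nbhd_mean_chain_le:
  assumes "0 \<le> C" "0 \<le> \<epsilon>" and V: "\<And>i. v i \<in> V"
    and link: "\<And>i. nbhd_mean (v i) (v (Suc i)) (shortfall C 2) \<le> \<epsilon>"
  shows "nbhd_mean (v 0) (v (Suc k)) (shortfall (C * (4 * C) ^ k) (3 * k + 2)) \<le> 8 ^ k * \<epsilon>"
proof (induction k)
  case 0
  show ?case using link[of 0] by (simp add: numeral_2_eq_2)
next
  case (Suc k)
  let ?C = "C * (4 * C) ^ k"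
  let ?f = "shortfall ?C (3 * k + 2)"
  have "C * (4 * C) ^ Suc k = 4 * ?C * C" "3 * Suc k + 2 = Suc ((3 * k + 2) + 2)" by simp_all
  then have "nbhd_mean (v 0) (v (Suc (Suc k))) (shortfall (C * (4 * C) ^ Suc k) (3 * Suc k + 2))
      = nbhd_mean (v 0) (v (Suc (Suc k))) (shortfall (4 * ?C * C) (Suc ((3 * k + 2) + 2)))"
    by (simp only:)
  also have "\<dots> \<le> nbhd_mean (v 0) (v (Suc (Suc k)))
      (\<lambda>s r. 4 * mean (\<lambda>t. adj (v (Suc k)) t * (?f s t + shortfall C 2 t r)))"
    using assms(1) by (intro nbhd_mean_mono shortfall_join V) auto
  also have "\<dots> = 4 * nbhd_mean (v 0) (v (Suc (Suc k)))
      (\<lambda>s r. mean (\<lambda>t. adj (v (Suc k)) t * (?f s t + shortfall C 2 t r)))"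
    by (simp add: nbhd_mean_def avg_mult_left mult.left_commute[of _ 4])
  also have "\<dots> \<le> 4 * (nbhd_mean (v 0) (v (Suc k)) ?f
      + nbhd_mean (v (Suc k)) (v (Suc (Suc k))) (shortfall C 2))"
    by (intro mult_left_mono nbhd_mean_join) auto
  also have "\<dots> \<le> 4 * (8 ^ k * \<epsilon> + 8 ^ k * \<epsilon>)"
    using Suc.IH order.trans[OF link[of "Suc k"], of "8 ^ k * \<epsilon>"] \<open>0 \<le> \<epsilon>\<close>
    by (intro mult_left_mono add_mono) (auto simp: mult_le_cancel_right1)
  finally show ?case by (simp add: mult_ac)
qed

lemma closed_walks_ge_shortfall:
  assumes "v \<in> V" "w \<in> V" "0 \<le> C" "0 \<le> C'"
  shows "1 / 16 \<le> C * C' * closed_walks (Suc (j + k))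
    + nbhd_mean v w (shortfall C j) + nbhd_mean w v (shortfall C' k)"
proof -
  have "1 / 16 = 1 / 4 * (1 / 4 :: real)" by simp
  also have "\<dots> \<le> mean (adj v) * mean (adj w)"
    using assms(1,2)[THEN mean_adj_ge_quarter] by (intro mult_mono) auto
  also have "\<dots> = nbhd_mean v w (\<lambda>_ _. 1)"
    by (simp add: nbhd_mean_def avg_mult_left avg_mult_right)
  also have "\<dots> \<le> mean (\<lambda>s. mean (\<lambda>t. C * C' * (walks j s t * walks k t s)
      + adj v s * adj w t * shortfall C j s t + adj w t * adj v s * shortfall C' k t s))"
    unfolding nbhd_mean_def
  proof (intro avg_mono)
    fix s t
    let ?W = "C * C' * (walks j s t * walks k t s)" and ?a = "adj v s * adj w t"
    have "1 \<le> ?W + (shortfall C j s t + shortfall C' k t s)"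
      using shortfall_mult[OF assms(3,4), of j s t k s] by (simp add: mult_ac)
    then have "?a * 1 \<le> ?a * (?W + (shortfall C j s t + shortfall C' k t s))"
      by (rule mult_left_mono) simp
    also have "\<dots> = ?a * ?W + ?a * shortfall C j s t + adj w t * adj v s * shortfall C' k t s"
      by (simp add: algebra_simps)
    also have "\<dots> \<le> ?W + ?a * shortfall C j s t + adj w t * adj v s * shortfall C' k t s"
      using assms by (intro add_right_mono mult_left_le_one_le) (auto intro: mult_le_one)
    finally show "?a * 1 \<le> ?W + ?a * shortfall C j s t + adj w t * adj v s * shortfall C' k t s" .
  qed
  also have "\<dots> = C * C' * closed_walks (Suc (j + k))
      + nbhd_mean v w (shortfall C j) + nbhd_mean w v (shortfall C' k)"
  proof -
    have "mean (\<lambda>s. mean (\<lambda>t. adj w t * adj v s * shortfall C' k t s))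
        = nbhd_mean w v (shortfall C' k)"
      unfolding nbhd_mean_def by (rule avg_swap)
    then show ?thesis by (simp add: nbhd_mean_def avg_add avg_mult_left mean_closed_walks2)
  qed
  finally show ?thesis .
qed

end

definition odd_walk_const :: "real \<Rightarrow> nat \<Rightarrow> real" where
  "odd_walk_const \<alpha> l = 8 / \<alpha> * (32 / \<alpha>) ^ (2 * l + 1) * (8 / \<alpha>) * (2 * (2 / \<alpha>) ^ (3 * l + 1))
     + (8 ^ (2 * l + 1) + 1) * (24 / \<alpha>)"

lemma odd_walk_const_pos: "0 < \<alpha> \<Longrightarrow> 0 < odd_walk_const \<alpha> l"
  unfolding odd_walk_const_def by (intro add_pos_pos mult_pos_pos) auto

context dense_graph begin

lemma odd_closed_walk_bound:
  assumes V: "\<And>i. v i \<in> V" and closed: "v (2 * l + 3) = v 0"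
    and sparse: "\<And>i. walks 3 (v i) (v (Suc i)) \<le> \<xi>" "\<And>i. walks 5 (v i) (v (Suc i)) \<le> \<xi>"
      "closed_walks 2 \<le> 2 * \<xi>" "closed_walks 4 \<le> 2 * \<xi>" "closed_walks 6 \<le> 2 * \<xi>"
  shows "1 / 16 \<le> odd_walk_const \<alpha> l * \<xi>"
proof -
  define k where "k = 2 * l + 1"
  define C where "C = 8 / \<alpha>"
  define C' where "C' = C * (4 * C) ^ k"
  define \<epsilon> where "\<epsilon> = 24 / \<alpha> * \<xi>"
  have "0 \<le> \<xi>" using sparse(3) closed_walks_nonneg[of 2] by simp
  have nonneg: "0 \<le> C" "0 \<le> C'" "0 \<le> \<epsilon>"
    using \<alpha>_pos \<open>0 \<le> \<xi>\<close> by (simp_all add: C_def C'_def \<epsilon>_def)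
  have link: "nbhd_mean (v i) (v (Suc i)) (shortfall C 2) \<le> \<epsilon>" for i
    using nbhd_mean_link_le sparse by (simp add: C_def \<epsilon>_def)
  have chain: "nbhd_mean (v 0) (v (Suc k)) (shortfall C' (3 * k + 2)) \<le> 8 ^ k * \<epsilon>"
    unfolding C'_def using nonneg V link by (intro nbhd_mean_chain_le)
  have "v (Suc (Suc k)) = v 0" using closed by (simp add: k_def eval_nat_numeral)
  then have last: "nbhd_mean (v (Suc k)) (v 0) (shortfall C 2) \<le> \<epsilon>"
    using link[of "Suc k"] by simp
  have "closed_walks (Suc (3 * k + 2 + 2)) \<le> 2 * (2 / \<alpha>) ^ (3 * l + 1) * \<xi>"
    using closed_walks_bound[OF sparse(3-5), of "3 * l + 1"] by (simp add: k_def)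
  then have "C' * C * closed_walks (Suc (3 * k + 2 + 2)) \<le> C' * C * (2 * (2 / \<alpha>) ^ (3 * l + 1) * \<xi>)"
    using nonneg by (intro mult_left_mono) auto
  then have "1 / 16 \<le> C' * C * (2 * (2 / \<alpha>) ^ (3 * l + 1) * \<xi>) + 8 ^ k * \<epsilon> + \<epsilon>"
    using closed_walks_ge_shortfall[OF V[of 0] V[of "Suc k"] nonneg(2,1), of "3 * k + 2" 2]
      chain last
    by linarith
  also have "\<dots> = odd_walk_const \<alpha> l * \<xi>"
    by (simp add: odd_walk_const_def C'_def C_def k_def \<epsilon>_def algebra_simps)
  finally show ?thesis .
qed

end

section \<open>Closed walks and colourings\<close>

lemma sym_relpow:
  assumes "sym R"
  shows "sym (R ^^ n)"
proof (induction n)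
  case (Suc n)
  show ?case
  proof (rule symI)
    fix u w assume "(u, w) \<in> R ^^ Suc n"
    then obtain v where "(u, v) \<in> R ^^ n" "(v, w) \<in> R" by (rule relpow_Suc_E)
    then show "(w, u) \<in> R ^^ Suc n"
      using assms Suc.IH by (meson relpow_Suc_I2 symD)
  qed
qed (simp add: sym_Id)

lemma relpow_closed_imp_periodic:
  assumes "(v, v) \<in> R ^^ n" "0 < n"
  shows "\<exists>f. (\<forall>i. (f i, f (Suc i)) \<in> R) \<and> (\<forall>i. f (i + n) = f i)"
proof -
  obtain g where g: "g 0 = v" "g n = v" "\<And>i. i < n \<Longrightarrow> (g i, g (Suc i)) \<in> R"
    using assms(1) unfolding relpow_fun_conv by blast
  have "(g (i mod n), g (Suc i mod n)) \<in> R" for i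
    using g(3)[of "i mod n"] g(1,2) \<open>0 < n\<close> by (auto simp: mod_Suc)
  then show ?thesis by (intro exI[of _ "\<lambda>i. g (i mod n)"]) simp
qed

lemma chromatic_number_le: "proper_colouring G k c \<Longrightarrow> chromatic_number G \<le> k"
  unfolding chromatic_number_def by (rule Least_le) blast

lemma proper_colouring_chromatic_number:
  assumes "finite (pverts G)" "\<And>u w. (u, w) \<in> parcs G \<Longrightarrow> u \<in> pverts G \<and> w \<in> pverts G \<and> u \<noteq> w"
  shows "\<exists>c. proper_colouring G (chromatic_number G) c"
proof -
  obtain c :: "'a \<Rightarrow> nat" and k where c: "c ` pverts G = {i. i < k}" "inj_on c (pverts G)"
    using finite_imp_inj_to_nat_seg[OF assms(1)] by blast
  have "c u \<noteq> c w" if "(u, w) \<in> parcs G" for u w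
    using assms(2)[OF that] inj_onD[OF c(2), of u w] by blast
  then have "proper_colouring G k c"
    unfolding proper_colouring_def using c(1) by auto
  then have "\<exists>k c. proper_colouring G k c" by blast
  then show ?thesis unfolding chromatic_number_def
    by (rule LeastI_ex[where P = "\<lambda>k. \<exists>c. proper_colouring G k c"])
qed

text \<open>
  Without odd closed walks, the parity of the walks from a fixed vertex of each component is a
  proper colouring.
\<close>

lemma odd_closed_walk_exists:
  assumes "pair_graph H" and not_bipartite: "\<And>c. \<not> proper_colouring H 2 c"
  shows "\<exists>v n. odd n \<and> (v, v) \<in> parcs H ^^ n"
proof (rule ccontr)
  interpret pair_graph H by fact
  assume "\<not> ?thesis"
  then have no_odd: "even n" if "(v, v) \<in> parcs H ^^ n" for v n using that by blast
  have sym: "sym (parcs H)" using arcs_symmetric by (auto intro: symI)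
  define root where "root v = (SOME r. (r, v) \<in> (parcs H)\<^sup>*)" for v
  have root: "(root v, v) \<in> (parcs H)\<^sup>*" for v
    unfolding root_def by (rule someI) (rule rtrancl_refl)
  define c :: "'a \<Rightarrow> nat" where "c v = of_bool (\<exists>n. even n \<and> (root v, v) \<in> parcs H ^^ n)" for v
  have "c u \<noteq> c w" if arc: "(u, w) \<in> parcs H" for u w
  proof
    assume "c u = c w"
    have "(r, u) \<in> (parcs H)\<^sup>* \<longleftrightarrow> (r, w) \<in> (parcs H)\<^sup>*" for r
      using arc symD[OF sym arc] by (meson rtrancl.rtrancl_into_rtrancl)
    then have "root u = root w" by (simp add: root_def)
    obtain m where m: "(root u, u) \<in> parcs H ^^ m" using root rtrancl_imp_relpow by blast
    consider j k where "even j" "(root u, u) \<in> parcs H ^^ j" "even k" "(root u, w) \<in> parcs H ^^ k"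
      | "odd m" "\<And>k. (root u, w) \<in> parcs H ^^ k \<Longrightarrow> odd k"
      using m \<open>c u = c w\<close> \<open>root u = root w\<close> unfolding c_def of_bool_eq_iff by metis
    then show False
    proof cases
      case 1
      have "(w, root u) \<in> parcs H ^^ k" using 1(4) sym_relpow[OF sym] by (meson symD)
      with relpow_Suc_I[OF 1(2) arc] have "(root u, root u) \<in> parcs H ^^ (Suc j + k)"
        by (rule relpow_trans)
      then show False using no_odd 1 by fastforce
    next
      case 2
      then show False using relpow_Suc_I[OF m arc] by fastforce
    qed
  qed
  moreover have "c v < 2" for v by (simp add: c_def)
  ultimately have "proper_colouring H 2 c" unfolding proper_colouring_def by blast
  then show False using not_bipartite by blast
qed

section \<open>Path patterns\<close>

text \<open>
  A path pattern exhibits \<open>H\<close> minus the edge \<open>xy\<close> inside a blow-up of a path with \<open>m\<close> edges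
  whose two end vertices, the images of \<open>x\<close> and \<open>y\<close>, are not blown up.
\<close>

definition path_pattern :: "'a pair_pre_digraph \<Rightarrow> 'a \<Rightarrow> 'a \<Rightarrow> nat \<Rightarrow> ('a \<Rightarrow> nat) \<Rightarrow> bool" where
  "path_pattern H x y m \<psi> \<longleftrightarrow> \<psi> x = 0 \<and> \<psi> y = m \<and>
     (\<forall>u \<in> pverts H - {x, y}. 0 < \<psi> u \<and> \<psi> u < m) \<and>
     (\<forall>(u, w) \<in> parcs H - {(x, y), (y, x)}. \<psi> w = Suc (\<psi> u) \<or> \<psi> u = Suc (\<psi> w))"

locale critical_graph = pair_graph H for H :: "'a pair_pre_digraph" +
  fixes x y :: 'a and c :: "'a \<Rightarrow> nat"
  assumes xy: "(x, y) \<in> parcs H"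
    and colouring: "proper_colouring (del_edge H x y) 2 c"
    and not_bipartite: "\<not> proper_colouring H 2 d"
    and no_triangle: "(x, u) \<in> parcs H \<Longrightarrow> (u, y) \<notin> parcs H"
begin

abbreviation "other_arcs \<equiv> parcs H - {(x, y), (y, x)}"

lemma x_neq_y: "x \<noteq> y" using xy no_loops' by auto

lemma xy_verts: "x \<in> pverts H" "y \<in> pverts H" using xy in_arcsD1 in_arcsD2 by auto

lemma other_arcs_verts: "(u, w) \<in> other_arcs \<Longrightarrow> u \<in> pverts H \<and> w \<in> pverts H"
  using in_arcsD1 in_arcsD2 by blast

lemma other_arcs_sym: "(u, w) \<in> other_arcs \<Longrightarrow> (w, u) \<in> other_arcs"
  using arcs_symmetric by blast

lemma colour_less: "u \<in> pverts H \<Longrightarrow> c u < 2"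
  using colouring by (auto simp: proper_colouring_def del_edge_def image_subset_iff)

lemma colour_arc: "(u, w) \<in> other_arcs \<Longrightarrow> c u \<noteq> c w"
  using colouring by (auto simp: proper_colouring_def del_edge_def)

lemma colour_arc_iff:
  assumes "(u, w) \<in> other_arcs" "v \<in> pverts H"
  shows "c u = c v \<longleftrightarrow> c w \<noteq> c v"
proof -
  have "c u < 2" "c w < 2" "c v < 2" "c u \<noteq> c w"
    using assms other_arcs_verts colour_less colour_arc by blast+
  then show ?thesis by linarith
qed

lemma colour_xy: "c x = c y"
proof (rule ccontr)
  assume "c x \<noteq> c y"
  then have "c u \<noteq> c w" if "(u, w) \<in> parcs H" for u w
    using colour_arc[of u w] that by (cases "(u, w) \<in> other_arcs") auto
  then have "proper_colouring H 2 c" unfolding proper_colouring_def using colour_less by blast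
  then show False using not_bipartite by blast
qed

lemma walk_parity:
  assumes "(u, w) \<in> other_arcs ^^ n" "u \<in> pverts H"
  shows "even n \<longleftrightarrow> c u = c w"
  using assms
proof (induction n arbitrary: u)
  case (Suc n)
  then obtain v where v: "(u, v) \<in> other_arcs" "(v, w) \<in> other_arcs ^^ n"
    by (blast elim: relpow_Suc_E2)
  have "w \<in> pverts H"
    using v other_arcs_verts by (cases n) (auto elim!: relpow_Suc_E)
  then show ?case
    using Suc.IH[OF v(2)] other_arcs_verts[OF v(1)] colour_arc_iff[OF v(1)] by simp
qed simp

text \<open>
  The distance from \<open>y\<close> in \<open>H - xy\<close>, where vertices farther than \<open>m - 1\<close> are folded onto
  \<open>m - 2\<close> and \<open>m - 1\<close> according to their colour.
\<close>

definition folded_distance :: "nat \<Rightarrow> 'a \<Rightarrow> nat" where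
  "folded_distance m u =
     (LEAST n. (u, y) \<in> other_arcs ^^ n \<or> n \<in> {m - 2, m - 1} \<and> (even n \<longleftrightarrow> c u = c y))"

context
  fixes m :: nat
  assumes m: "even m" "2 < m"
begin

lemma folded_distance_cases:
  obtains "(u, y) \<in> other_arcs ^^ folded_distance m u"
    | "folded_distance m u \<in> {m - 2, m - 1}" "even (folded_distance m u) \<longleftrightarrow> c u = c y"
proof -
  have "\<exists>n. (u, y) \<in> other_arcs ^^ n \<or> n \<in> {m - 2, m - 1} \<and> (even n \<longleftrightarrow> c u = c y)"
    using m by (intro exI[of _ "if c u = c y then m - 2 else m - 1"]) simp
  then have "(u, y) \<in> other_arcs ^^ folded_distance m u
      \<or> folded_distance m u \<in> {m - 2, m - 1} \<and> (even (folded_distance m u) \<longleftrightarrow> c u = c y)"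
    unfolding folded_distance_def by (rule LeastI_ex)
  then show ?thesis using that by blast
qed

lemma folded_distance_le_walk: "(u, y) \<in> other_arcs ^^ n \<Longrightarrow> folded_distance m u \<le> n"
  unfolding folded_distance_def by (rule Least_le) blast

lemma folded_distance_le_fold:
  "n \<in> {m - 2, m - 1} \<Longrightarrow> even n \<longleftrightarrow> c u = c y \<Longrightarrow> folded_distance m u \<le> n"
  unfolding folded_distance_def by (rule Least_le) blast

lemma folded_distance_less: "folded_distance m u < m"
  using folded_distance_le_fold[of "m - 2" u] folded_distance_le_fold[of "m - 1" u] m
  by (cases "c u = c y") auto

lemma folded_distance_parity:
  assumes "u \<in> pverts H"
  shows "even (folded_distance m u) \<longleftrightarrow> c u = c y"
proof (cases rule: folded_distance_cases[of u])
  case 1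
  then show ?thesis using assms by (rule walk_parity)
qed

lemma folded_distance_eq_0: "folded_distance m u = 0 \<longleftrightarrow> u = y"
proof
  assume "folded_distance m u = 0"
  with m show "u = y" by (cases rule: folded_distance_cases[of u]) auto
qed (use folded_distance_le_walk[of y 0] in simp)

lemma folded_distance_arc_le:
  assumes arc: "(u, w) \<in> other_arcs"
  shows "folded_distance m w \<le> Suc (folded_distance m u)"
proof (cases rule: folded_distance_cases[of u])
  case 1
  then show ?thesis
    using relpow_Suc_I2[OF other_arcs_sym[OF arc]] by (intro folded_distance_le_walk)
next
  case 2
  then have "folded_distance m w \<le> (if folded_distance m u = m - 2 then m - 1 else m - 2)"
    using colour_arc_iff[OF arc xy_verts(2)] m
    by (intro folded_distance_le_fold) (auto split: if_splits)
  then show ?thesis using 2 by (auto split: if_splits)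
qed

lemma folded_distance_arc:
  assumes arc: "(u, w) \<in> other_arcs"
  shows "folded_distance m w = Suc (folded_distance m u)
    \<or> folded_distance m u = Suc (folded_distance m w)"
proof -
  have "even (folded_distance m u) \<longleftrightarrow> odd (folded_distance m w)"
    using folded_distance_parity other_arcs_verts[OF arc] colour_arc_iff[OF arc xy_verts(2)] by simp
  then have "folded_distance m u \<noteq> folded_distance m w" by auto
  then show ?thesis
    using folded_distance_arc_le[OF arc] folded_distance_arc_le[OF other_arcs_sym[OF arc]]
    by linarith
qed

lemma path_pattern_exists:
  assumes far: "\<And>n. n < m \<Longrightarrow> (x, y) \<notin> other_arcs ^^ n"
  shows "\<exists>\<psi>. path_pattern H x y m \<psi>"
proof -
  define \<psi> where "\<psi> u = (if u = x then 0 else m - folded_distance m u)" for u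
  have nbr_x: "folded_distance m w = m - 1" if arc: "(x, w) \<in> other_arcs" for w
  proof (cases rule: folded_distance_cases[of w])
    case 1
    then have "m \<le> Suc (folded_distance m w)"
      using far[of "Suc (folded_distance m w)"] relpow_Suc_I2[OF arc] by fastforce
    then show ?thesis using folded_distance_less[of w] by simp
  next
    case 2
    then show ?thesis using m colour_arc[OF arc] colour_xy by auto
  qed
  have "\<psi> w = Suc (\<psi> u) \<or> \<psi> u = Suc (\<psi> w)" if arc: "(u, w) \<in> other_arcs" for u w
  proof -
    consider "u = x" "w \<noteq> x" | "w = x" "u \<noteq> x" | "u \<noteq> x" "w \<noteq> x"
      using arc no_loops' by auto
    then show ?thesis
    proof cases
      case 1
      then show ?thesis using nbr_x[of w] arc m by (simp add: \<psi>_def)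
    next
      case 2
      then show ?thesis using nbr_x[of u] other_arcs_sym[OF arc] m by (simp add: \<psi>_def)
    next
      case 3
      then show ?thesis
        using folded_distance_arc[OF arc] folded_distance_less[of u] folded_distance_less[of w]
        by (auto simp: \<psi>_def)
    qed
  qed
  moreover have "\<psi> x = 0" "\<psi> y = m"
    using x_neq_y folded_distance_eq_0[of y] by (simp_all add: \<psi>_def)
  moreover have "0 < \<psi> u \<and> \<psi> u < m" if "u \<in> pverts H - {x, y}" for u
    using that folded_distance_eq_0[of u] folded_distance_less[of u] by (auto simp: \<psi>_def)
  ultimately have "path_pattern H x y m \<psi>" unfolding path_pattern_def by blast
  then show ?thesis by blast
qed

end

lemma walk_length:
  assumes walk: "(x, y) \<in> other_arcs ^^ n"
  shows "even n" "4 \<le> n"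
proof -
  show "even n" using walk walk_parity xy_verts colour_xy by blast
  have "n \<noteq> 0" using walk x_neq_y by (cases n) auto
  moreover have "n \<noteq> 2" using walk no_triangle by (auto simp: numeral_2_eq_2)
  ultimately show "4 \<le> n" using \<open>even n\<close> by (auto elim!: evenE)
qed

lemma path_pattern4: "\<exists>\<psi>. path_pattern H x y 4 \<psi>"
  using walk_length(2) by (intro path_pattern_exists) fastforce+

lemma path_pattern6:
  assumes "(x, y) \<notin> other_arcs ^^ 4"
  shows "\<exists>\<psi>. path_pattern H x y 6 \<psi>"
proof (rule path_pattern_exists)
  fix n :: nat assume "n < 6"
  show "(x, y) \<notin> other_arcs ^^ n"
  proof
    assume walk: "(x, y) \<in> other_arcs ^^ n"
    then have "n = 4" using walk_length[OF walk] \<open>n < 6\<close> by (auto elim!: evenE)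
    then show False using walk assms by simp
  qed
qed simp_all

end

section \<open>Rich arcs\<close>

text \<open>
  Homomorphisms are represented by their restriction to \<open>pverts H - {x, y}\<close>, since \<open>x\<close> and \<open>y\<close>
  are sent to \<open>a\<close> and \<open>b\<close>.
\<close>

definition edge_homs ::
    "'a pair_pre_digraph \<Rightarrow> 'a \<Rightarrow> 'a \<Rightarrow> 'b pair_pre_digraph \<Rightarrow> 'b \<Rightarrow> 'b \<Rightarrow> ('a \<Rightarrow> 'b) set" where
  "edge_homs H x y G a b = {f \<in> (pverts H - {x, y}) \<rightarrow>\<^sub>E pverts G.
     \<forall>(u, w) \<in> parcs H. ((f(x := a, y := b)) u, (f(x := a, y := b)) w) \<in> parcs G}"

definition rich_arcs ::
    "real \<Rightarrow> 'a pair_pre_digraph \<Rightarrow> 'a \<Rightarrow> 'a \<Rightarrow> 'b pair_pre_digraph \<Rightarrow> ('b \<times> 'b) set" where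
  "rich_arcs \<kappa> H x y G = {(a, b) \<in> parcs G.
     \<kappa> * real (card (pverts G)) ^ card (pverts H - {x, y}) \<le> real (card (edge_homs H x y G a b))}"

lemma finite_labelled_copies:
  assumes "pair_graph H" "pair_graph G"
  shows "finite (labelled_copies H G)"
proof -
  interpret H: pair_graph H by fact
  interpret G: pair_graph G by fact
  show ?thesis
    using H.pair_finite_verts G.pair_finite_verts
    by (auto simp: labelled_copies_def
        intro!: finite_subset[OF _ finite_PiE[of "pverts H" "\<lambda>_. pverts G"]])
qed

context nonempty_graph begin

lemma transversal_walks_imp_hom:
  assumes "pair_graph H" "(x, y) \<in> parcs H" and ab: "(a, b) \<in> parcs G"
    and pattern: "path_pattern H x y (Suc k) \<psi>"
    and walks: "\<And>s. s \<in> transversals {1..k} p \<psi> (pverts H - {x, y}) f \<Longrightarrow> is_walk k a b s"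
    and arc: "(u, w) \<in> parcs H"
  shows "((f(x := a, y := b)) u, (f(x := a, y := b)) w) \<in> parcs G"
proof -
  interpret H: pair_graph H by fact
  define e where "e = f(x := a, y := b)"
  have "x \<noteq> y" using assms(2) H.no_loops' by auto
  have step: "(e u, e w) \<in> parcs G" if "u \<in> pverts H" "w \<in> pverts H" "\<psi> w = Suc (\<psi> u)" for u w
  proof -
    have level: "z = x \<and> \<psi> z = 0 \<and> e z = a \<or> z = y \<and> \<psi> z = Suc k \<and> e z = b
        \<or> z \<in> pverts H - {x, y} \<and> \<psi> z \<in> {1..k} \<and> e z = f z" if "z \<in> pverts H" for z
      using pattern \<open>x \<noteq> y\<close> that by (auto simp: path_pattern_def e_def Suc_le_eq less_Suc_eq_le)
    define s where "s = (\<lambda>i\<in>{1..k}. if i = \<psi> u then e u else if i = \<psi> w then e w else p i)"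
    have "s \<in> transversals {1..k} p \<psi> (pverts H - {x, y}) f"
      using level[OF that(1)] level[OF that(2)] unfolding transversals_def s_def
      by (intro PiE_I) auto
    then have "is_walk k a b s" by (rule walks)
    moreover have "\<psi> u \<le> k" "(s(0 := a, Suc k := b)) (\<psi> u) = e u"
      "(s(0 := a, Suc k := b)) (\<psi> w) = e w"
      using level[OF that(1)] level[OF that(2)] that(3) by (auto simp: s_def)
    ultimately show ?thesis unfolding is_walk_def by (metis that(3))
  qed
  have verts: "u \<in> pverts H" "w \<in> pverts H" using arc H.in_arcsD1 H.in_arcsD2 by auto
  consider "(u, w) = (x, y)" | "(u, w) = (y, x)" | "\<psi> w = Suc (\<psi> u)" | "\<psi> u = Suc (\<psi> w)"
    using pattern arc unfolding path_pattern_def by blast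
  then have "(e u, e w) \<in> parcs G"
  proof cases
    case 1 then show ?thesis using ab \<open>x \<noteq> y\<close> by (simp add: e_def)
  next
    case 2 then show ?thesis using arcs_symmetric[OF ab] \<open>x \<noteq> y\<close> by (simp add: e_def)
  next
    case 3 then show ?thesis using step verts by blast
  next
    case 4 then show ?thesis using step verts arcs_symmetric by blast
  qed
  then show ?thesis by (simp add: e_def)
qed

lemma edge_homs_ge:
  assumes H: "pair_graph H" "(x, y) \<in> parcs H" and ab: "(a, b) \<in> parcs G"
    and pattern: "path_pattern H x y (Suc k) \<psi>"
  shows "walks k a b ^ 2 ^ card (pverts H - {x, y}) * real (card V) ^ card (pverts H - {x, y})
    \<le> real (card (edge_homs H x y G a b))"
proof -
  interpret H: pair_graph H by fact
  let ?U = "pverts H - {x, y}"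
  define hom where "hom f \<longleftrightarrow>
    (\<forall>(u, w) \<in> parcs H. ((f(x := a, y := b)) u, (f(x := a, y := b)) w) \<in> parcs G)" for f
  have fin: "finite ?U" "finite V" using H.pair_finite_verts pair_finite_verts by auto
  have levels: "\<psi> ` ?U \<subseteq> {1..k}"
  proof (rule image_subsetI)
    fix u assume "u \<in> ?U"
    then have "0 < \<psi> u \<and> \<psi> u < Suc k" using pattern unfolding path_pattern_def by blast
    then show "\<psi> u \<in> {1..k}" by auto
  qed
  have "walks k a b ^ 2 ^ card ?U = avg ({1..k} \<rightarrow>\<^sub>E V) (\<lambda>p. of_bool (is_walk k a b p)) ^ 2 ^ card ?U"
    by (simp add: walks_eq_avg)
  also have "\<dots> \<le> avg (?U \<rightarrow>\<^sub>E V) (\<lambda>f. avg ({1..k} \<rightarrow>\<^sub>E V)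
      (\<lambda>p. of_bool (\<forall>s \<in> transversals {1..k} p \<psi> ?U f. is_walk k a b s)))"
    by (rule blowup_density[OF fin(1) levels])
  also have "\<dots> \<le> avg (?U \<rightarrow>\<^sub>E V) (\<lambda>f. of_bool (hom f))"
  proof (intro avg_mono avg_le)
    fix f p
    show "of_bool (\<forall>s \<in> transversals {1..k} p \<psi> ?U f. is_walk k a b s) \<le> (of_bool (hom f) :: real)"
      using transversal_walks_imp_hom[OF H ab pattern] unfolding hom_def by force
  qed (use fin verts_ne in \<open>simp_all add: PiE_eq_empty_iff finite_PiE\<close>)
  also have "\<dots> = real (card (edge_homs H x y G a b)) / real (card V) ^ card ?U"
    using fin by (simp add: avg_of_bool finite_PiE card_PiE edge_homs_def hom_def)
  finally show ?thesis
    using fin verts_ne by (simp add: pos_le_divide_eq card_gt_0_iff)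
qed

lemma walks_le_of_not_rich:
  assumes H: "pair_graph H" "(x, y) \<in> parcs H" and pattern: "path_pattern H x y (Suc k) \<psi>"
    and "0 \<le> \<eta>" and ab: "(a, b) \<in> parcs G - rich_arcs (\<eta> ^ 2 ^ card (pverts H - {x, y})) H x y G"
  shows "walks k a b \<le> \<eta>"
proof (rule ccontr)
  let ?t = "card (pverts H - {x, y})"
  assume "\<not> walks k a b \<le> \<eta>"
  then have "\<eta> ^ 2 ^ ?t * real (card V) ^ ?t \<le> walks k a b ^ 2 ^ ?t * real (card V) ^ ?t"
    using \<open>0 \<le> \<eta>\<close> by (intro mult_right_mono power_mono) auto
  also have "\<dots> \<le> real (card (edge_homs H x y G a b))"
    using ab by (intro edge_homs_ge[OF H _ pattern]) simp
  finally show False using ab by (simp add: rich_arcs_def)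
qed

lemma card_injective_edge_homs_le:
  assumes "pair_graph H" "(x, y) \<in> parcs H" "(a, b) \<in> parcs G" and U: "U = pverts H - {x, y}"
  shows "card {f \<in> edge_homs H x y G a b. inj_on f U \<and> f ` U \<inter> {a, b} = {}}
    \<le> card {f \<in> labelled_copies H G. f x = a \<and> f y = b}"
proof (rule card_inj_on_le[where f = "\<lambda>f. f(x := a, y := b)"])
  interpret H: pair_graph H by fact
  let ?I = "{f \<in> edge_homs H x y G a b. inj_on f U \<and> f ` U \<inter> {a, b} = {}}"
  have xy: "x \<noteq> y" "x \<in> pverts H" "y \<in> pverts H"
    using assms(2) H.no_loops' H.in_arcsD1 H.in_arcsD2 by auto
  have ab: "a \<noteq> b" "a \<in> V" "b \<in> V" using assms(3) no_loops' arc_verts by auto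
  show "inj_on (\<lambda>f. f(x := a, y := b)) ?I"
  proof (rule inj_onI)
    fix f g assume "f \<in> ?I" "g \<in> ?I" and eq: "f(x := a, y := b) = g(x := a, y := b)"
    moreover have "f u = g u" if "u \<in> U" for u using fun_cong[OF eq, of u] that U by auto
    ultimately show "f = g"
      using U by (intro PiE_ext[of f U "\<lambda>_. V" g]) (simp_all add: edge_homs_def)
  qed
  show "(\<lambda>f. f(x := a, y := b)) ` ?I \<subseteq> {f \<in> labelled_copies H G. f x = a \<and> f y = b}"
  proof (rule image_subsetI)
    fix f assume "f \<in> ?I"
    then have hom: "f \<in> edge_homs H x y G a b"
      and f: "f \<in> U \<rightarrow>\<^sub>E V" "inj_on f U" "f ` U \<inter> {a, b} = {}"
      unfolding edge_homs_def U by blast+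
    define g where "g = f(x := a, y := b)"
    have "g \<in> pverts H \<rightarrow>\<^sub>E V" using f(1) ab xy U by (auto simp: g_def PiE_iff extensional_def)
    moreover have "inj_on g (pverts H)"
    proof (rule inj_onI)
      fix u w assume uw: "u \<in> pverts H" "w \<in> pverts H" "g u = g w"
      have "f z \<noteq> a" "f z \<noteq> b" if "z \<in> U" for z using f(3) that by auto
      then show "u = w"
        using uw inj_onD[OF f(2), of u w] ab(1) U by (auto simp: g_def split: if_splits)
    qed
    moreover have "\<forall>(u, w) \<in> parcs H. (g u, g w) \<in> parcs G"
      using hom unfolding g_def edge_homs_def by blast
    moreover have "g x = a" "g y = b" using xy(1) by (simp_all add: g_def)
    ultimately show "f(x := a, y := b) \<in> {f \<in> labelled_copies H G. f x = a \<and> f y = b}"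
      unfolding g_def[symmetric] by (simp add: labelled_copies_def)
  qed
  show "finite {f \<in> labelled_copies H G. f x = a \<and> f y = b}"
    using finite_labelled_copies[OF assms(1) pair_graph_axioms] by simp
qed

lemma card_copies_through_arc_ge:
  assumes "pair_graph H" "(x, y) \<in> parcs H" "(a, b) \<in> parcs G"
  shows "real (card (edge_homs H x y G a b))
      - real (card (pverts H)) ^ 2 / real (card V) * real (card V) ^ card (pverts H - {x, y})
    \<le> real (card {f \<in> labelled_copies H G. f x = a \<and> f y = b})"
proof -
  interpret H: pair_graph H by fact
  define U where "U = pverts H - {x, y}"
  define I where "I = {f \<in> edge_homs H x y G a b. inj_on f U \<and> f ` U \<inter> {a, b} = {}}"
  define B where "B = {f \<in> U \<rightarrow>\<^sub>E V. \<not> (inj_on f U \<and> f ` U \<inter> {a, b} = {})}"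
  have fin: "finite U" "finite V" using H.pair_finite_verts pair_finite_verts by (auto simp: U_def)
  have xy: "x \<noteq> y" "x \<in> pverts H" "y \<in> pverts H"
    using assms(2) H.no_loops' H.in_arcsD1 H.in_arcsD2 by auto
  then have "card {x, y} \<le> card (pverts H)" using H.pair_finite_verts by (intro card_mono) auto
  then have card_H: "card U \<le> card (pverts H)" "card U + card {a, b} \<le> card (pverts H)"
    using xy H.pair_finite_verts assms(3) no_loops'
    by (auto simp: U_def card_Diff_subset)
  have "real (card B) / real (card V) ^ card U
      = avg (U \<rightarrow>\<^sub>E V) (\<lambda>f. of_bool (\<not> (inj_on f U \<and> f ` U \<inter> {a, b} = {})))"
    using fin by (subst avg_of_bool) (simp_all add: B_def card_PiE finite_PiE)
  also have "\<dots> \<le> real (card U * (card U + card {a, b})) / real (card V)"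
    using fin verts_ne by (intro not_inj_avoiding_density) auto
  also have "\<dots> \<le> real (card (pverts H) * card (pverts H)) / real (card V)"
    by (intro divide_right_mono of_nat_mono mult_le_mono card_H) simp
  finally have B: "real (card B)
      \<le> real (card (pverts H)) ^ 2 / real (card V) * real (card V) ^ card U"
    using fin verts_ne by (simp add: pos_divide_le_eq card_gt_0_iff power2_eq_square)
  have "edge_homs H x y G a b \<subseteq> I \<union> B" by (auto simp: edge_homs_def I_def B_def U_def)
  moreover have "finite (U \<rightarrow>\<^sub>E V)" using fin by (simp add: finite_PiE)
  then have "finite (I \<union> B)"
    by (rule rev_finite_subset) (auto simp: edge_homs_def I_def B_def U_def)
  ultimately have "card (edge_homs H x y G a b) \<le> card I + card B"
    by (meson card_mono card_Un_le order.trans)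
  also have "card I \<le> card {f \<in> labelled_copies H G. f x = a \<and> f y = b}"
    unfolding I_def by (rule card_injective_edge_homs_le[OF assms U_def])
  finally have "real (card (edge_homs H x y G a b))
      \<le> real (card {f \<in> labelled_copies H G. f x = a \<and> f y = b}) + real (card B)"
    by linarith
  then show ?thesis using B unfolding U_def by linarith
qed

lemma card_labelled_copies_ge_rich:
  assumes "pair_graph H" "(x, y) \<in> parcs H" "0 < \<kappa>"
    and large: "2 * real (card (pverts H)) ^ 2 \<le> \<kappa> * real (card V)"
  shows "real (card (rich_arcs \<kappa> H x y G)) * (\<kappa> / 2 * real (card V) ^ card (pverts H - {x, y}))
    \<le> real (card (labelled_copies H G))"
proof -
  let ?t = "card (pverts H - {x, y})" and ?n = "real (card V)" and ?R = "rich_arcs \<kappa> H x y G"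
  let ?C = "\<lambda>(a, b). {f \<in> labelled_copies H G. f x = a \<and> f y = b}"
  have fin: "finite (labelled_copies H G)"
    by (rule finite_labelled_copies[OF assms(1) pair_graph_axioms])
  have "?R \<subseteq> parcs G" by (auto simp: rich_arcs_def)
  then have "finite ?R" using pair_finite_arcs finite_subset by blast
  have "0 < ?n" using verts_ne pair_finite_verts by (simp add: card_gt_0_iff)
  then have "real (card (pverts H)) ^ 2 / ?n \<le> \<kappa> / 2"
    unfolding pos_divide_le_eq[OF \<open>0 < ?n\<close>] using large by linarith
  then have few: "real (card (pverts H)) ^ 2 / ?n * ?n ^ ?t \<le> \<kappa> / 2 * ?n ^ ?t"
    by (rule mult_right_mono) simp
  have "\<kappa> / 2 * ?n ^ ?t \<le> real (card (?C p))" if "p \<in> ?R" for p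
  proof -
    obtain a b where p: "p = (a, b)" by (cases p)
    then have "(a, b) \<in> parcs G" "\<kappa> * ?n ^ ?t \<le> real (card (edge_homs H x y G a b))"
      using that by (auto simp: rich_arcs_def)
    then show ?thesis
      using card_copies_through_arc_ge[OF assms(1,2), of a b] few unfolding p prod.case by linarith
  qed
  then have "real (card ?R) * (\<kappa> / 2 * ?n ^ ?t) \<le> (\<Sum>p\<in>?R. real (card (?C p)))"
    using sum_bounded_below[of ?R "\<kappa> / 2 * ?n ^ ?t" "\<lambda>p. real (card (?C p))"] by simp
  also have "\<dots> = real (card (\<Union>p\<in>?R. ?C p))"
    using \<open>finite ?R\<close> fin by (subst card_UN_disjoint) (auto split: prod.splits)
  also have "\<dots> \<le> real (card (labelled_copies H G))"
    using fin by (intro of_nat_mono card_mono) auto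
  finally show ?thesis .
qed

end

section \<open>Every copy contains a rich arc, or there are many\<close>

context dense_graph begin

lemma pentagon_avoiding_bound:
  assumes R: "R \<subseteq> parcs G" "real (card R) \<le> \<xi> * real (card V) ^ 2"
    and sparse: "\<And>a b. (a, b) \<in> parcs G - R \<Longrightarrow> walks 3 a b \<le> \<xi>\<^sup>2 / 16" and \<xi>: "0 \<le> \<xi>" "\<xi> \<le> 1"
    and v: "\<And>i. (v i, v (Suc i)) \<in> parcs G - R" "\<And>i. v (i + 5) = v i"
  shows "\<alpha> ^ 7 \<le> 18 * \<xi>"
proof (rule pentagon_bound)
  have "\<xi>\<^sup>2 / 16 \<le> \<xi>" using \<xi> mult_left_le[of \<xi> \<xi>] by (simp add: power2_eq_square)
  then show "walks 3 (v i) (v (Suc i)) \<le> \<xi>" for i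
    using sparse[OF v(1)] by (rule order.trans[rotated])
  have codeg: "codeg a b \<le> \<xi>" if "(a, b) \<in> parcs G - R" for a b
    using that arc_verts[of a b] by (intro codeg_le sparse \<xi>) auto
  then show "codeg (v i) (v (Suc i)) \<le> \<xi>" for i using v(1) by blast
  show "closed_walks 2 \<le> 2 * \<xi>"
    using closed_walks_le[OF R codeg \<xi>(1)] by (simp add: numeral_2_eq_2)
  show "v i \<in> V" for i using v(1)[of i] arc_verts by blast
qed (rule v(2))

lemma odd_closed_walk_avoiding_bound:
  assumes R: "R \<subseteq> parcs G" "real (card R) \<le> \<xi> * real (card V) ^ 2"
    and sparse: "\<And>a b. (a, b) \<in> parcs G - R \<Longrightarrow> walks 3 a b \<le> \<xi>\<^sup>2 / 16"
      "\<And>a b. (a, b) \<in> parcs G - R \<Longrightarrow> walks 5 a b \<le> \<xi>\<^sup>2 / 16" and \<xi>: "0 \<le> \<xi>" "\<xi> \<le> 1"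
    and v: "\<And>i. (v i, v (Suc i)) \<in> parcs G - R" "\<And>i. v (i + (2 * l + 3)) = v i"
  shows "1 / 16 \<le> odd_walk_const \<alpha> l * \<xi>"
proof (rule odd_closed_walk_bound)
  have "\<xi>\<^sup>2 / 16 \<le> \<xi>" using \<xi> mult_left_le[of \<xi> \<xi>] by (simp add: power2_eq_square)
  then have walks: "walks 3 a b \<le> \<xi>" "walks 5 a b \<le> \<xi>" if "(a, b) \<in> parcs G - R" for a b
    using sparse[OF that] by linarith+
  show "walks 3 (v i) (v (Suc i)) \<le> \<xi>" "walks 5 (v i) (v (Suc i)) \<le> \<xi>" for i
    using walks[OF v(1)] by blast+
  have codeg: "codeg a b \<le> \<xi>" if "(a, b) \<in> parcs G - R" for a b
    using that arc_verts[of a b] by (intro codeg_le sparse \<xi>) auto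
  show "closed_walks 2 \<le> 2 * \<xi>" "closed_walks 4 \<le> 2 * \<xi>" "closed_walks 6 \<le> 2 * \<xi>"
    using closed_walks_le[OF R codeg \<xi>(1)] closed_walks_le[OF R walks(1) \<xi>(1)]
      closed_walks_le[OF R walks(2) \<xi>(1)] by (simp_all add: eval_nat_numeral)
  show "v i \<in> V" for i using v(1)[of i] arc_verts by blast
  show "v (2 * l + 3) = v 0" using v(2)[of 0] by simp
qed

end

definition many_or_hitting ::
    "real \<Rightarrow> 'a pair_pre_digraph \<Rightarrow> 'b pair_pre_digraph \<Rightarrow> ('b \<times> 'b) set \<Rightarrow> bool" where
  "many_or_hitting \<xi> H G R \<longleftrightarrow> \<xi> * real (card (pverts G)) ^ 2 \<le> real (card R) \<or>
     (\<forall>\<phi> \<in> labelled_copies H G. \<exists>(u, w) \<in> parcs H. (\<phi> u, \<phi> w) \<in> R)"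

lemma many_or_hittingI:
  assumes walk: "\<And>i. (f i, f (Suc i)) \<in> parcs H" "\<And>i. f (i + n) = f i"
    and unavoidable: "\<And>v. real (card R) \<le> \<xi> * real (card (pverts G)) ^ 2 \<Longrightarrow>
      (\<And>i. (v i, v (Suc i)) \<in> parcs G - R) \<Longrightarrow> (\<And>i. v (i + n) = v i) \<Longrightarrow> False"
  shows "many_or_hitting \<xi> H G R"
proof (rule ccontr)
  assume "\<not> many_or_hitting \<xi> H G R"
  then obtain \<phi> where few: "real (card R) \<le> \<xi> * real (card (pverts G)) ^ 2"
    and \<phi>: "\<phi> \<in> labelled_copies H G" and avoids: "\<forall>(u, w) \<in> parcs H. (\<phi> u, \<phi> w) \<notin> R"
    unfolding many_or_hitting_def not_le de_Morgan_disj by (blast intro: less_imp_le)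
  have "(\<phi> (f i), \<phi> (f (Suc i))) \<in> parcs G - R" for i
    using walk(1)[of i] \<phi> avoids unfolding labelled_copies_def by blast
  then show False using unavoidable[OF few, of "\<lambda>i. \<phi> (f i)"] walk(2) by simp
qed

context critical_graph begin

lemma rich_arcs_pentagon:
  assumes "dense_graph G \<alpha>" and f: "\<And>i. (f i, f (Suc i)) \<in> parcs H" "\<And>i. f (i + 5) = f i"
    and \<xi>: "0 < \<xi>" "\<xi> \<le> 1" "18 * \<xi> < \<alpha> ^ 7"
  shows "many_or_hitting \<xi> H G (rich_arcs ((\<xi>\<^sup>2 / 16) ^ 2 ^ card (pverts H - {x, y})) H x y G)"
    (is "many_or_hitting \<xi> H G ?R")
proof -
  interpret G: dense_graph G \<alpha> by fact
  obtain \<psi> where \<psi>: "path_pattern H x y (Suc 3) \<psi>" using path_pattern4 by auto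
  have sub: "?R \<subseteq> parcs G" by (auto simp: rich_arcs_def)
  have walks3: "G.walks 3 a b \<le> \<xi>\<^sup>2 / 16" if "(a, b) \<in> parcs G - ?R" for a b
    using G.walks_le_of_not_rich[OF pair_graph_axioms xy \<psi> _ that] by simp
  show ?thesis
  proof (rule many_or_hittingI[OF f])
    fix v
    assume few: "real (card ?R) \<le> \<xi> * real (card (pverts G)) ^ 2"
      and v: "\<And>i. (v i, v (Suc i)) \<in> parcs G - ?R" "\<And>i. v (i + 5) = v i"
    have "\<alpha> ^ 7 \<le> 18 * \<xi>"
      using \<xi>(1,2) by (intro G.pentagon_avoiding_bound[OF sub few walks3 _ _ v]) auto
    then show False using \<xi>(3) by simp
  qed
qed

lemma rich_arcs_no_pentagon:
  assumes "dense_graph G \<alpha>" and f: "\<And>i. (f i, f (Suc i)) \<in> parcs H" "\<And>i. f (i + (2 * l + 3)) = f i"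
    and no_pentagon: "(x, y) \<notin> other_arcs ^^ 4"
    and \<xi>: "0 < \<xi>" "\<xi> \<le> 1" "odd_walk_const \<alpha> l * \<xi> < 1 / 16"
  shows "many_or_hitting \<xi> H G (rich_arcs ((\<xi>\<^sup>2 / 16) ^ 2 ^ card (pverts H - {x, y})) H x y G)"
    (is "many_or_hitting \<xi> H G ?R")
proof -
  interpret G: dense_graph G \<alpha> by fact
  obtain \<psi> where \<psi>: "path_pattern H x y (Suc 3) \<psi>" using path_pattern4 by auto
  obtain \<psi>' where \<psi>': "path_pattern H x y (Suc 5) \<psi>'" using path_pattern6[OF no_pentagon] by auto
  have sub: "?R \<subseteq> parcs G" by (auto simp: rich_arcs_def)
  have walks3: "G.walks 3 a b \<le> \<xi>\<^sup>2 / 16" if "(a, b) \<in> parcs G - ?R" for a b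
    using G.walks_le_of_not_rich[OF pair_graph_axioms xy \<psi> _ that] by simp
  have walks5: "G.walks 5 a b \<le> \<xi>\<^sup>2 / 16" if "(a, b) \<in> parcs G - ?R" for a b
    using G.walks_le_of_not_rich[OF pair_graph_axioms xy \<psi>' _ that] by simp
  show ?thesis
  proof (rule many_or_hittingI[OF f])
    fix v
    assume few: "real (card ?R) \<le> \<xi> * real (card (pverts G)) ^ 2"
      and v: "\<And>i. (v i, v (Suc i)) \<in> parcs G - ?R" "\<And>i. v (i + (2 * l + 3)) = v i"
    have "1 / 16 \<le> odd_walk_const \<alpha> l * \<xi>"
      using \<xi>(1,2) by (intro G.odd_closed_walk_avoiding_bound[OF sub few walks3 walks5 _ _ v]) auto
    then show False using \<xi>(3) by simp
  qed
qed

lemma rich_arcs_many_or_hitting: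
  assumes "0 < \<alpha>" "\<alpha> \<le> 1"
  shows "\<exists>\<xi>>0. \<exists>\<kappa>>0. \<forall>G :: 'b pair_pre_digraph. dense_graph G \<alpha> \<longrightarrow>
    many_or_hitting \<xi> H G (rich_arcs \<kappa> H x y G)"
proof (cases "(x, y) \<in> other_arcs ^^ 4")
  case True
  then have "(x, y) \<in> parcs H ^^ 4" unfolding relpow_fun_conv by blast
  then have "(x, x) \<in> parcs H ^^ 5"
    using relpow_Suc_I[OF _ arcs_symmetric[OF xy], of x 4] by simp
  then obtain f where f: "\<And>i. (f i, f (Suc i)) \<in> parcs H" "\<And>i. f (i + 5) = f i"
    using relpow_closed_imp_periodic[of x 5 "parcs H"] by auto
  define \<xi> where "\<xi> = \<alpha> ^ 7 / 19"
  have \<xi>: "0 < \<xi>" "\<xi> \<le> 1" "18 * \<xi> < \<alpha> ^ 7"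
    using assms power_le_one[of \<alpha> 7] by (simp_all add: \<xi>_def)
  have "0 < (\<xi>\<^sup>2 / 16) ^ 2 ^ card (pverts H - {x, y})" using \<xi>(1) by simp
  then show ?thesis using \<xi>(1) rich_arcs_pentagon[OF _ f \<xi>] by blast
next
  case False
  obtain v n where walk: "odd n" "(v, v) \<in> parcs H ^^ n"
    using odd_closed_walk_exists[OF pair_graph_axioms not_bipartite] by blast
  define l where "l = n div 2 - 1"
  have "n \<noteq> 1" using walk(2) no_loops'[of v v] by auto
  then have "n = 2 * l + 3" using walk(1) unfolding l_def by presburger
  with walk(2) obtain f where f: "\<And>i. (f i, f (Suc i)) \<in> parcs H" "\<And>i. f (i + (2 * l + 3)) = f i"
    using relpow_closed_imp_periodic[of v "2 * l + 3" "parcs H"] by auto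
  define \<xi> where "\<xi> = min 1 (1 / (32 * odd_walk_const \<alpha> l))"
  have const: "0 < odd_walk_const \<alpha> l" by (rule odd_walk_const_pos[OF assms(1)])
  then have "odd_walk_const \<alpha> l * \<xi> \<le> odd_walk_const \<alpha> l * (1 / (32 * odd_walk_const \<alpha> l))"
    by (intro mult_left_mono) (auto simp: \<xi>_def)
  then have \<xi>: "0 < \<xi>" "\<xi> \<le> 1" "odd_walk_const \<alpha> l * \<xi> < 1 / 16"
    using const by (auto simp: \<xi>_def)
  have "0 < (\<xi>\<^sup>2 / 16) ^ 2 ^ card (pverts H - {x, y})" using \<xi>(1) by simp
  then show ?thesis using \<xi>(1) rich_arcs_no_pentagon[OF _ f False \<xi>] by blast
qed

end

section \<open>The linear removal threshold\<close>

lemma card_edge_disjoint_copies_le_hitting: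
  assumes "finite R" "edge_disjoint_copies H G F"
    and hit: "\<forall>\<phi> \<in> labelled_copies H G. \<exists>(u, w) \<in> parcs H. (\<phi> u, \<phi> w) \<in> R"
  shows "card F \<le> card R"
proof -
  have "\<exists>p. p \<in> map_prod f f ` parcs H \<and> p \<in> R" if "f \<in> F" for f
    using hit that assms(2) by (force simp: edge_disjoint_copies_def)
  then obtain r where r: "\<And>f. f \<in> F \<Longrightarrow> r f \<in> map_prod f f ` parcs H" "\<And>f. f \<in> F \<Longrightarrow> r f \<in> R"
    by metis
  have "inj_on r F"
  proof (rule inj_onI, rule ccontr)
    fix f g assume fg: "f \<in> F" "g \<in> F" "r f = r g" "f \<noteq> g"
    then have "map_prod f f ` parcs H \<inter> map_prod g g ` parcs H = {}"
      using assms(2) by (auto simp: edge_disjoint_copies_def disjoint_family_on_def)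
    then show False using r(1)[OF fg(1)] r(1)[OF fg(2)] fg(3) by (metis IntI empty_iff)
  qed
  then show ?thesis using r(2) assms(1) by (intro card_inj_on_le[of r]) auto
qed

lemma card_ge_of_many_or_hitting:
  assumes "many_or_hitting \<xi> H G R" "finite R" "edge_disjoint_copies H G F"
    and F: "\<epsilon> * real (card (pverts G)) ^ 2 \<le> real (card F)" and "0 < \<epsilon>" "\<epsilon> \<le> 1" "0 < \<xi>"
  shows "min 1 \<xi> * \<epsilon> * real (card (pverts G)) ^ 2 \<le> real (card R)"
  using assms(1) unfolding many_or_hitting_def
proof
  assume "\<xi> * real (card (pverts G)) ^ 2 \<le> real (card R)"
  moreover have "min 1 \<xi> * \<epsilon> * real (card (pverts G)) ^ 2 \<le> \<xi> * 1 * real (card (pverts G)) ^ 2"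
    using assms(5-7) by (intro mult_mono) auto
  ultimately show ?thesis by simp
next
  assume "\<forall>\<phi> \<in> labelled_copies H G. \<exists>(u, w) \<in> parcs H. (\<phi> u, \<phi> w) \<in> R"
  then have "real (card F) \<le> real (card R)"
    using card_edge_disjoint_copies_le_hitting[OF assms(2,3)] by simp
  moreover have "min 1 \<xi> * (\<epsilon> * real (card (pverts G)) ^ 2) \<le> 1 * (\<epsilon> * real (card (pverts G)) ^ 2)"
    using assms(5) by (intro mult_right_mono) auto
  ultimately show ?thesis using F by (simp add: mult.assoc)
qed

context critical_graph begin

lemma card_verts: "card (pverts H) = card (pverts H - {x, y}) + 2"
proof -
  have "card {x, y} \<le> card (pverts H)" using xy_verts pair_finite_verts by (intro card_mono) auto
  then show ?thesis using xy_verts pair_finite_verts x_neq_y by (simp add: card_Diff_subset)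
qed

lemma labelled_copies_ge_few_verts:
  assumes "pair_graph G" "edge_disjoint_copies H G F"
    and F: "\<epsilon> * real (card (pverts G)) ^ 2 \<le> real (card F)" and "0 < \<epsilon>"
    and few: "real (card (pverts G)) \<le> N" "0 < N"
  shows "(1 / N) ^ card (pverts H - {x, y}) * \<epsilon> * real (card (pverts G)) ^ card (pverts H)
    \<le> real (card (labelled_copies H G))"
proof -
  let ?n = "real (card (pverts G))" and ?t = "card (pverts H - {x, y})"
  have "(1 / N) ^ ?t * \<epsilon> * ?n ^ card (pverts H) = \<epsilon> * ?n ^ 2 * (?n / N) ^ ?t"
    unfolding card_verts power_add by (simp add: power_divide mult_ac)
  also have "\<dots> \<le> \<epsilon> * ?n ^ 2"
    using few \<open>0 < \<epsilon>\<close> by (intro mult_left_le power_le_one) auto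
  also have "\<dots> \<le> real (card F)" by (rule F)
  also have "\<dots> \<le> real (card (labelled_copies H G))"
    using assms(2) finite_labelled_copies[OF pair_graph_axioms assms(1)]
    by (intro of_nat_mono card_mono) (auto simp: edge_disjoint_copies_def)
  finally show ?thesis .
qed

lemma labelled_copies_ge_many_verts:
  assumes "pair_graph G" "pverts G \<noteq> {}" "edge_disjoint_copies H G F"
    and F: "\<epsilon> * real (card (pverts G)) ^ 2 \<le> real (card F)" and \<epsilon>: "0 < \<epsilon>" "\<epsilon> \<le> 1"
    and rich: "many_or_hitting \<xi> H G (rich_arcs \<kappa> H x y G)" and pos: "0 < \<xi>" "0 < \<kappa>"
    and many: "2 * real (card (pverts H)) ^ 2 \<le> \<kappa> * real (card (pverts G))"
  shows "min 1 \<xi> * (\<kappa> / 2) * \<epsilon> * real (card (pverts G)) ^ card (pverts H)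
    \<le> real (card (labelled_copies H G))"
proof -
  interpret G: nonempty_graph G
    using assms(1,2) by (intro nonempty_graph.intro nonempty_graph_axioms.intro)
  let ?n = "real (card (pverts G))" and ?t = "card (pverts H - {x, y})"
  let ?R = "rich_arcs \<kappa> H x y G"
  have "finite ?R" by (rule finite_subset[OF _ G.pair_finite_arcs]) (auto simp: rich_arcs_def)
  have "min 1 \<xi> * (\<kappa> / 2) * \<epsilon> * ?n ^ card (pverts H)
      = (min 1 \<xi> * \<epsilon> * ?n ^ 2) * (\<kappa> / 2 * ?n ^ ?t)"
    unfolding card_verts power_add by (simp add: mult_ac)
  also have "\<dots> \<le> real (card ?R) * (\<kappa> / 2 * ?n ^ ?t)"
    using pos card_ge_of_many_or_hitting[OF rich \<open>finite ?R\<close> assms(3) F \<epsilon>]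
    by (intro mult_right_mono) auto
  also have "\<dots> \<le> real (card (labelled_copies H G))"
    by (rule G.card_labelled_copies_ge_rich[OF pair_graph_axioms xy pos(2) many])
  finally show ?thesis .
qed

lemma labelled_copies_linear:
  fixes N \<mu> :: real
  assumes G: "pair_graph G" "edge_disjoint_copies H G F"
    and F: "\<epsilon> * real (card (pverts G)) ^ 2 \<le> real (card F)" and \<epsilon>: "0 < \<epsilon>" "\<epsilon> \<le> 1"
    and rich: "pverts G \<noteq> {} \<Longrightarrow> many_or_hitting \<xi> H G (rich_arcs \<kappa> H x y G)"
    and pos: "0 < \<xi>" "0 < \<kappa>"
  defines "N \<equiv> 2 * real (card (pverts H)) ^ 2 / \<kappa>"
  defines "\<mu> \<equiv> min ((1 / N) ^ card (pverts H - {x, y})) (min 1 \<xi> * (\<kappa> / 2))"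
  shows "\<mu> * \<epsilon> * real (card (pverts G)) ^ card (pverts H) \<le> real (card (labelled_copies H G))"
proof -
  have "0 < N" using pos card_verts by (simp add: N_def)
  have scale: "\<mu> * \<epsilon> * real (card (pverts G)) ^ card (pverts H)
      \<le> \<nu> * \<epsilon> * real (card (pverts G)) ^ card (pverts H)" if "\<mu> \<le> \<nu>" for \<nu>
    using that \<epsilon> by (intro mult_right_mono) auto
  show ?thesis
  proof (cases "real (card (pverts G)) \<le> N")
    case True
    show ?thesis
      by (rule order.trans[OF scale labelled_copies_ge_few_verts[OF G F \<epsilon>(1) True \<open>0 < N\<close>]])
        (simp add: \<mu>_def)
  next
    case False
    then have "pverts G \<noteq> {}" using \<open>0 < N\<close> by auto
    moreover have "2 * real (card (pverts H)) ^ 2 \<le> \<kappa> * real (card (pverts G))"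
      using False pos(2) by (simp add: N_def not_le pos_divide_less_eq mult.commute)
    ultimately show ?thesis
      by (intro order.trans[OF scale labelled_copies_ge_many_verts[OF G(1) _ G(2) F \<epsilon> rich pos]])
        (simp_all add: \<mu>_def)
  qed
qed

lemma removal_bound_linear:
  assumes "0 < \<alpha>" "\<alpha> \<le> 1"
  shows "\<exists>\<mu>>0. \<forall>\<epsilon>. 0 < \<epsilon> \<and> \<epsilon> \<le> 1 \<longrightarrow> removal_bound \<epsilon> H (1 / 4 + \<alpha>) (\<mu> * \<epsilon>)"
proof -
  obtain \<xi> \<kappa> where pos: "0 < \<xi>" "0 < \<kappa>" and rich: "\<And>G :: nat pair_pre_digraph.
      dense_graph G \<alpha> \<Longrightarrow> many_or_hitting \<xi> H G (rich_arcs \<kappa> H x y G)"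
    using rich_arcs_many_or_hitting[OF assms] by metis
  define N where "N = 2 * real (card (pverts H)) ^ 2 / \<kappa>"
  define \<mu> where "\<mu> = min ((1 / N) ^ card (pverts H - {x, y})) (min 1 \<xi> * (\<kappa> / 2))"
  have "0 < \<mu>" using pos card_verts by (simp add: \<mu>_def N_def)
  moreover have "removal_bound \<epsilon> H (1 / 4 + \<alpha>) (\<mu> * \<epsilon>)" if \<epsilon>: "0 < \<epsilon>" "\<epsilon> \<le> 1" for \<epsilon>
    unfolding removal_bound_def
  proof (intro allI impI, elim conjE exE)
    fix G :: "nat pair_pre_digraph" and n F
    assume G: "pair_graph G" "edge_disjoint_copies H G F" and n: "card (pverts G) = n"
      and degree: "\<forall>v \<in> pverts G. (1 / 4 + \<alpha>) * real n \<le> real (out_degree G v)"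
      and F: "\<epsilon> * real n ^ 2 \<le> real (card F)"
    have "dense_graph G \<alpha>" if "pverts G \<noteq> {}"
      using that G(1) degree n assms(1)
      by (intro dense_graph.intro nonempty_graph.intro nonempty_graph_axioms.intro
          dense_graph_axioms.intro) auto
    then show "\<mu> * \<epsilon> * real n ^ card (pverts H) \<le> real (card (labelled_copies H G))"
      using labelled_copies_linear[OF G F[folded n] \<epsilon> rich pos] by (simp add: \<mu>_def N_def n)
  qed
  ultimately show ?thesis by blast
qed

end

lemma critical_graph_exists:
  assumes "pair_graph H" "chromatic_number H = 3" "critical_edge H x y" "odd_girth H \<ge> 5"
  shows "\<exists>c. critical_graph H x y c"
proof -
  interpret pair_graph H by fact
  have xy: "(x, y) \<in> parcs H" and less: "chromatic_number (del_edge H x y) < 3"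
    using assms by (auto simp: critical_edge_def)
  have "\<exists>c. proper_colouring (del_edge H x y) (chromatic_number (del_edge H x y)) c"
    using pair_finite_verts in_arcsD1 in_arcsD2 no_loops'
    by (intro proper_colouring_chromatic_number) (auto simp: del_edge_def)
  then obtain c where "proper_colouring (del_edge H x y) (chromatic_number (del_edge H x y)) c" ..
  then have "proper_colouring (del_edge H x y) 2 c"
    using less by (force simp: proper_colouring_def subset_iff)
  moreover have "\<not> proper_colouring H 2 d" for d
    using chromatic_number_le[of H 2 d] assms(2) by auto
  moreover have "(u, y) \<notin> parcs H" if "(x, u) \<in> parcs H" for u
  proof
    assume uy: "(u, y) \<in> parcs H"
    have "x \<noteq> y" "x \<noteq> u" "u \<noteq> y" "x \<in> pverts H" "y \<in> pverts H" "u \<in> pverts H"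
      using xy that uy no_loops' in_arcsD1 in_arcsD2 by auto
    then have "cycle [(x, u), (u, y), (y, x)]"
      using that uy arcs_symmetric[OF xy] unfolding cycle_def
      by (auto simp: awalk_def intro!: exI[of _ x])
    then have "odd_girth H \<le> enat (length [(x, u), (u, y), (y, x)])"
      unfolding odd_girth_def by (intro INF_lower) auto
    then have "odd_girth H \<le> 3" by (simp add: numeral_eq_enat eval_nat_numeral)
    with assms(4) have "(5 :: enat) \<le> 3" by (rule order.trans)
    then show False by simp
  qed
  ultimately have "critical_graph H x y c"
    using xy by unfold_locales
  then show ?thesis by blast
qed

lemma removal_bound_mono:
  assumes "removal_bound \<epsilon> H \<gamma> d" "d' \<le> d"
  shows "removal_bound \<epsilon> H \<gamma> d'"
proof -
  have "d' * real n ^ k \<le> d * real n ^ k" for n k :: nat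
    using assms(2) by (rule mult_right_mono) simp
  then show ?thesis using assms(1) unfolding removal_bound_def by (blast intro: order.trans)
qed

lemma delta_lin_rem_le:
  assumes "0 \<le> \<gamma>" "\<gamma> \<le> 1" "0 < \<mu>"
    and bound: "\<And>\<epsilon>. 0 < \<epsilon> \<Longrightarrow> \<epsilon> \<le> 1 \<Longrightarrow> removal_bound \<epsilon> H \<gamma> (\<mu> * \<epsilon>)"
  shows "delta_lin_rem H \<le> \<gamma>"
  unfolding delta_lin_rem_def
proof (rule cInf_lower)
  let ?\<mu> = "min 1 \<mu>"
  have "?\<mu> * \<epsilon> \<le> removal_delta \<epsilon> H \<gamma>" if "0 < \<epsilon>" "\<epsilon> \<le> 1" for \<epsilon>
  proof (rule removal_delta_is_maximum(2))
    show "?\<mu> * \<epsilon> \<in> {0..1}" using that \<open>0 < \<mu>\<close> by (auto intro!: mult_le_one)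
    show "removal_bound \<epsilon> H \<gamma> (?\<mu> * \<epsilon>)"
      using bound[OF that] by (rule removal_bound_mono) (use that in \<open>simp add: mult_right_mono\<close>)
  qed
  then show "\<gamma> \<in> {\<gamma> \<in> {0..1}. \<exists>\<mu>>0. \<forall>\<epsilon>. 0 < \<epsilon> \<and> \<epsilon> \<le> 1 \<longrightarrow> \<mu> * \<epsilon> \<le> removal_delta \<epsilon> H \<gamma>}"
    using assms(1-3) by (auto intro!: exI[of _ ?\<mu>])
qed (rule bdd_belowI[of _ 0], auto)

theorem theorem5p7:
  fixes H :: "'a pair_pre_digraph"
  assumes "pair_graph H"
    and "chromatic_number H = 3"
    and "\<exists>x y. critical_edge H x y"
    and "odd_girth H \<ge> 5"
  shows "delta_lin_rem H \<le> 1 / 4"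
proof (rule field_le_epsilon)
  obtain x y where "critical_edge H x y" using assms(3) by blast
  then obtain c where "critical_graph H x y c"
    using critical_graph_exists[OF assms(1,2) _ assms(4)] by blast
  then interpret critical_graph H x y c .
  fix e :: real assume "e > 0"
  define \<alpha> where "\<alpha> = min e (1 / 2)"
  have \<alpha>: "0 < \<alpha>" "\<alpha> \<le> 1 / 2" "\<alpha> \<le> e" using \<open>e > 0\<close> by (auto simp: \<alpha>_def)
  obtain \<mu> where "0 < \<mu>"
    and "\<And>\<epsilon>. 0 < \<epsilon> \<Longrightarrow> \<epsilon> \<le> 1 \<Longrightarrow> removal_bound \<epsilon> H (1 / 4 + \<alpha>) (\<mu> * \<epsilon>)"
    using removal_bound_linear[of \<alpha>] \<alpha> by auto
  then have "delta_lin_rem H \<le> 1 / 4 + \<alpha>" using \<alpha> by (intro delta_lin_rem_le) auto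
  then show "delta_lin_rem H \<le> 1 / 4 + e" using \<alpha>(3) by simp
qed

end
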